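(* Let $n\geq 1$ and let $\vec m=(m_x)_{x\in C^{(n)}_0}$ be a tuple of natural numbers with $m_x\geq 2$. A simplicial distribution on the bundle scenario $f_m:E(C^{(n)},\vec m)\to C^{(n)}$ is a contextual vertex of $\mathrm{sDist}(f_m)$ if and only if it is a $k$-order cycle distribution for some $k\geq 2$.
   Context: For a set $U$, $D(U)$ is the set of functions $p:U\to\mathbb{R}_{\geq 0}$ with finite support and $\sum_{u\in U}p(u)=1$; for a function $f:U\to V$, $D(f):D(U)\to D(V)$ is the push-forward $D(f)(p)(v)=\sum_{u\in f^{-1}(v)}p(u)$. For a simplicial set $Y$, $D(Y)$ is the simplicial set with $D(Y)_n=D(Y_n)$ and structure maps $D(d_i)$, $D(s_j)$; $\delta_Y:Y\to D(Y)$ sends a simplex to the delta distribution at it. A simplicial map $f:E\to Y$ induces $D(f):D(E)\to D(Y)$. A bundle scenario is a simplicial map $f:E\to X$. A simplicial distribution on $f$ is a simplicial map $p:X\to D(E)$ with $D(f)\circ p=\delta_X$ (so $p_x\in D(f^{-1}(x))$); the set of these is $\mathrm{sDist}(f)$, a convex set. A deterministic distribution on $f$ is one of the form $\delta_E\circ\varphi$ with $\varphi:X\to E$ a section of $f$. A simplicial distribution is noncontextual if it is a (finite) convex combination of deterministic ones, and contextual otherwise. $p$ is a vertex if $p=\alpha q+(1-\alpha)\tilde q$ with $q,\tilde q\in\mathrm{sDist}(f)$ and $0<\alpha\leq1$ implies $p=q$. The $n$-circle $C^{(n)}$ is the $1$-dimensional simplicial set (a directed $n$-cycle) whose non-degenerate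 simplices are pairwise distinct $1$-simplices $\sigma_1,\dots,\sigma_n$ and pairwise distinct $0$-simplices $v_1,\dots,v_n$, with $d_1(\sigma_i)=v_i$, $d_0(\sigma_i)=d_1(\sigma_{i+1})$ for $1\leq i\leq n-1$, and $d_0(\sigma_n)=d_1(\sigma_1)$. $\mathbb{Z}_d=\{0,\dots,d-1\}$. For a set $U$, $\Delta_U$ is the simplicial set with $(\Delta_U)_n=U^{n+1}$, where $d_i$ deletes the coordinate $x_i$ of $(x_0,\dots,x_n)$ and $s_j$ repeats $x_j$. The bundle $f_m$. For a $1$-dimensional simplicial set $X$ and $\vec m=(m_x)_{x\in X_0}$ with $m_x\geq2$, $E(X,\vec m)$ is the $1$-dimensional simplicial set with $E(X,\vec m)_0=\bigsqcup_{x\in X_0}\{x\}\times\mathbb{Z}_{m_x}$, $E(X,\vec m)_1=\bigsqcup_{\sigma\in X_1}\{\sigma\}\times\mathbb{Z}_{m_{d_1(\sigma)}}\times\mathbb{Z}_{m_{d_0(\sigma)}}$ and structure maps $d_1(\sigma,(i,j))=(d_1(\sigma),i)$, $d_0(\sigma,(i,j))=(d_0(\sigma),j)$, $s_0(x,i)=(s_0(x),(i,i))$ (all higher simplices are degenerate). $f_m:E(X,\vec m)\to X$ is the projection. $k$-order cycle distributions. First, for $1\leq k\leq d$, a simplicial map $p:C^{(n)}\to D(\Delta_{\mathbb{Z}_d})$ (with $p_{\sigma_i}^{ab}=p_{\sigma_i}((a,b))$) is a $k$-order cycle distribution if there are $a_i^{(j)}\in\mathbb{Z}_d$ ($1\leq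 i\leq n$, $1\leq j\leq k$) with $a_i^{(j)}\neq a_i^{(s)}$ for all $i$ and all $j\neq s$, such that: for $1\leq i\leq n-1$, $p_{\sigma_i}^{ab}=\frac1k$ if $(a,b)=(a_i^{(j)},a_{i+1}^{(j)})$ for some $1\leq j\leq k$, and $0$ otherwise; and $p_{\sigma_n}^{ab}=\frac1k$ if $(a,b)=(a_n^{(j)},a_1^{(j+1)})$ for some $1\leq j\leq k-1$ or $(a,b)=(a_n^{(k)},a_1^{(1)})$, and $0$ otherwise. Next, let $m=\max\{m_x: x\in C^{(n)}_0\}$ and let $i:E(C^{(n)},\vec m)\hookrightarrow C^{(n)}\times\Delta_{\mathbb{Z}_m}$ be the injective simplicial map over $C^{(n)}$ induced by the inclusions $\mathbb{Z}_{m_x}=\{0,\dots,m_x-1\}\subseteq\{0,\dots,m-1\}=\mathbb{Z}_m$. For $p\in\mathrm{sDist}(f_m)$, $i_*(p)=D(i)\circ p$ is a simplicial distribution on the projection $\mathrm{pr}_1:C^{(n)}\times\Delta_{\mathbb{Z}_m}\to C^{(n)}$, and $\mathrm{sDist}(\mathrm{pr}_1)$ is identified with the set of simplicial maps $C^{(n)}\to D(\Delta_{\mathbb{Z}_m})$ (by composing with $D$ of the second projection). A simplicial distribution $p$ on $f_m$ is called a $k$-order cycle distribution if $i_*(p)$ is a $k$-order cycle distribution in the previous sense (with $d=m$). *)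

theory Defs
  imports Complex_Main
begin

section \<open>Simplicial sets\<close>

text \<open>\<open>face X k i\<close> is the map $d_i$ on $X_k$ (for $1 \le k$) and \<open>degen X k j\<close> is $s_j$ on $X_k$.
  The operators carry the dimension because the same value of type \<open>'a\<close> may occur in
  several dimensions; only their values on \<open>simp X k\<close> matter.\<close>

record 'a sset =
  simp :: "nat \<Rightarrow> 'a set"
  face :: "nat \<Rightarrow> nat \<Rightarrow> 'a \<Rightarrow> 'a"
  degen :: "nat \<Rightarrow> nat \<Rightarrow> 'a \<Rightarrow> 'a"

definition simplicial_set :: "'a sset \<Rightarrow> bool" where
  "simplicial_set X \<longleftrightarrow>
     (\<forall>k. \<forall>x\<in>simp X (Suc k). \<forall>i\<le>Suc k. face X (Suc k) i x \<in> simp X k) \<and>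
     (\<forall>k. \<forall>x\<in>simp X k. \<forall>j\<le>k. degen X k j x \<in> simp X (Suc k)) \<and>
     (\<forall>k. \<forall>x\<in>simp X (Suc (Suc k)). \<forall>j\<le>Suc (Suc k). \<forall>i<j.
        face X (Suc k) i (face X (Suc (Suc k)) j x)
          = face X (Suc k) (j - 1) (face X (Suc (Suc k)) i x)) \<and>
     (\<forall>k. \<forall>x\<in>simp X k. \<forall>j\<le>k. \<forall>i\<le>j.
        degen X (Suc k) i (degen X k j x) = degen X (Suc k) (Suc j) (degen X k i x)) \<and>
     (\<forall>k. \<forall>x\<in>simp X k. \<forall>j\<le>k. \<forall>i\<le>Suc k.
        face X (Suc k) i (degen X k j x) =
          (if i < j then degen X (k - 1) (j - 1) (face X k i x)
           else if i \<le> Suc j then x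
           else degen X (k - 1) j (face X k (i - 1) x)))"

definition simplicial_map :: "'a sset \<Rightarrow> 'b sset \<Rightarrow> (nat \<Rightarrow> 'a \<Rightarrow> 'b) \<Rightarrow> bool" where
  "simplicial_map X Y f \<longleftrightarrow>
     (\<forall>k. \<forall>x\<in>simp X k. f k x \<in> simp Y k) \<and>
     (\<forall>k. \<forall>x\<in>simp X (Suc k). \<forall>i\<le>Suc k. f k (face X (Suc k) i x) = face Y (Suc k) i (f (Suc k) x)) \<and>
     (\<forall>k. \<forall>x\<in>simp X k. \<forall>j\<le>k. f (Suc k) (degen X k j x) = degen Y k j (f k x))"

definition nondegenerate :: "'a sset \<Rightarrow> nat \<Rightarrow> 'a set" where
  "nondegenerate X k = {x \<in> simp X k. \<not> (\<exists>l. k = Suc l \<and> (\<exists>j\<le>l. \<exists>y\<in>simp X l. x = degen X l j y))}"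

definition prod_sset :: "'a sset \<Rightarrow> 'b sset \<Rightarrow> ('a \<times> 'b) sset" where
  "prod_sset X Y =
     \<lparr>simp = (\<lambda>k. simp X k \<times> simp Y k),
      face = (\<lambda>k i. map_prod (face X k i) (face Y k i)),
      degen = (\<lambda>k j. map_prod (degen X k j) (degen Y k j))\<rparr>"

definition delete_nth :: "nat \<Rightarrow> 'u list \<Rightarrow> 'u list" where
  "delete_nth i xs = take i xs @ drop (Suc i) xs"

definition repeat_nth :: "nat \<Rightarrow> 'u list \<Rightarrow> 'u list" where
  "repeat_nth j xs = take (Suc j) xs @ drop j xs"

text \<open>The tuple $(x_0,\dots,x_k) \in U^{k+1}$ is the list of length $k+1$ with these entries.\<close>

definition Delta :: "'u set \<Rightarrow> 'u list sset" where
  "Delta U =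
     \<lparr>simp = (\<lambda>k. {xs. length xs = Suc k \<and> set xs \<subseteq> U}),
      face = (\<lambda>k i. delete_nth i),
      degen = (\<lambda>k j. repeat_nth j)\<rparr>"

section \<open>Distributions\<close>

definition distributions :: "'a set \<Rightarrow> ('a \<Rightarrow> real) set" where
  "distributions U =
     {p. finite {u. p u \<noteq> 0} \<and> {u. p u \<noteq> 0} \<subseteq> U \<and> (\<forall>u. 0 \<le> p u) \<and> (\<Sum>u | p u \<noteq> 0. p u) = 1}"

definition push :: "('a \<Rightarrow> 'b) \<Rightarrow> ('a \<Rightarrow> real) \<Rightarrow> 'b \<Rightarrow> real" where
  "push f p = (\<lambda>v. \<Sum>u | p u \<noteq> 0 \<and> f u = v. p u)"

definition delta :: "'a \<Rightarrow> 'a \<Rightarrow> real" where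
  "delta u = (\<lambda>v. if v = u then 1 else 0)"

definition D :: "'a sset \<Rightarrow> ('a \<Rightarrow> real) sset" where
  "D Y =
     \<lparr>simp = (\<lambda>k. distributions (simp Y k)),
      face = (\<lambda>k i. push (face Y k i)),
      degen = (\<lambda>k j. push (degen Y k j))\<rparr>"

section \<open>Simplicial distributions\<close>

text \<open>Simplicial maps are total HOL functions whose values outside the simplices are irrelevant,
  so all equations between them are stated simplexwise.\<close>

definition sDist :: "'e sset \<Rightarrow> 'x sset \<Rightarrow> (nat \<Rightarrow> 'e \<Rightarrow> 'x) \<Rightarrow> (nat \<Rightarrow> 'x \<Rightarrow> 'e \<Rightarrow> real) set" where
  "sDist E X f =
     {p. simplicial_map X (D E) p \<and> (\<forall>k. \<forall>x\<in>simp X k. push (f k) (p k x) = delta x)}"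

definition is_section :: "'e sset \<Rightarrow> 'x sset \<Rightarrow> (nat \<Rightarrow> 'e \<Rightarrow> 'x) \<Rightarrow> (nat \<Rightarrow> 'x \<Rightarrow> 'e) \<Rightarrow> bool" where
  "is_section E X f \<phi> \<longleftrightarrow> simplicial_map X E \<phi> \<and> (\<forall>k. \<forall>x\<in>simp X k. f k (\<phi> k x) = x)"

definition deterministic ::
    "'e sset \<Rightarrow> 'x sset \<Rightarrow> (nat \<Rightarrow> 'e \<Rightarrow> 'x) \<Rightarrow> (nat \<Rightarrow> 'x \<Rightarrow> 'e \<Rightarrow> real) \<Rightarrow> bool" where
  "deterministic E X f q \<longleftrightarrow>
     (\<exists>\<phi>. is_section E X f \<phi> \<and> (\<forall>k. \<forall>x\<in>simp X k. q k x = delta (\<phi> k x)))"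

definition noncontextual ::
    "'e sset \<Rightarrow> 'x sset \<Rightarrow> (nat \<Rightarrow> 'e \<Rightarrow> 'x) \<Rightarrow> (nat \<Rightarrow> 'x \<Rightarrow> 'e \<Rightarrow> real) \<Rightarrow> bool" where
  "noncontextual E X f p \<longleftrightarrow>
     (\<exists>(N::nat) w q. (\<forall>r<N. 0 \<le> w r \<and> deterministic E X f (q r)) \<and> (\<Sum>r<N. w r) = (1::real) \<and>
        (\<forall>k. \<forall>x\<in>simp X k. \<forall>e. p k x e = (\<Sum>r<N. w r * q r k x e)))"

definition contextual ::
    "'e sset \<Rightarrow> 'x sset \<Rightarrow> (nat \<Rightarrow> 'e \<Rightarrow> 'x) \<Rightarrow> (nat \<Rightarrow> 'x \<Rightarrow> 'e \<Rightarrow> real) \<Rightarrow> bool" where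
  "contextual E X f p \<longleftrightarrow> p \<in> sDist E X f \<and> \<not> noncontextual E X f p"

definition vertex ::
    "'e sset \<Rightarrow> 'x sset \<Rightarrow> (nat \<Rightarrow> 'e \<Rightarrow> 'x) \<Rightarrow> (nat \<Rightarrow> 'x \<Rightarrow> 'e \<Rightarrow> real) \<Rightarrow> bool" where
  "vertex E X f p \<longleftrightarrow> p \<in> sDist E X f \<and>
     (\<forall>q\<in>sDist E X f. \<forall>q'\<in>sDist E X f. \<forall>\<alpha>::real. 0 < \<alpha> \<longrightarrow> \<alpha> \<le> 1 \<longrightarrow>
        (\<forall>k. \<forall>x\<in>simp X k. \<forall>e. p k x e = \<alpha> * q k x e + (1 - \<alpha>) * q' k x e) \<longrightarrow>
        (\<forall>k. \<forall>x\<in>simp X k. p k x = q k x))"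

section \<open>The circle\<close>

text \<open>\<open>Vert i\<close> in dimension $k$ is the $k$-fold degeneracy of $v_i$. \<open>Edge i c\<close> in dimension $k$,
  $1 \le c \le k$, is the degeneracy of $\sigma_i$ along the monotone surjection $[k] \to [1]$ that
  sends $0,\dots,c-1$ to $0$ and $c,\dots,k$ to $1$; thus $\sigma_i$ is \<open>Edge i 1\<close> in dimension 1.\<close>

datatype circ = Vert nat | Edge nat nat

definition circle_succ :: "nat \<Rightarrow> nat \<Rightarrow> nat" where
  "circle_succ n i = (if i = n then 1 else Suc i)"

fun circle_face :: "nat \<Rightarrow> nat \<Rightarrow> nat \<Rightarrow> circ \<Rightarrow> circ" where
  "circle_face n k j (Vert i) = Vert i"
| "circle_face n k j (Edge i c) =
     (if j = 0 \<and> c = 1 then Vert (circle_succ n i)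
      else if j = k \<and> c = k then Vert i
      else Edge i (if j < c then c - 1 else c))"

fun circle_degen :: "nat \<Rightarrow> nat \<Rightarrow> circ \<Rightarrow> circ" where
  "circle_degen k j (Vert i) = Vert i"
| "circle_degen k j (Edge i c) = Edge i (if j < c then Suc c else c)"

definition circle :: "nat \<Rightarrow> circ sset" where
  "circle n =
     \<lparr>simp = (\<lambda>k. Vert ` {1..n} \<union> {Edge i c | i c. i \<in> {1..n} \<and> c \<in> {1..k}}),
      face = circle_face n,
      degen = circle_degen\<rparr>"

definition circle_edge :: "nat \<Rightarrow> circ" where
  "circle_edge i = Edge i 1"

section \<open>The bundle\<close>

text \<open>Simplices of $E(X,\vec m)$ are written as pairs consisting of a simplex of $X$ and the list of
  labels of its vertices, so $(\sigma,(i,j))$ is \<open>(\<sigma>, [i, j])\<close> and the structure maps are those of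
  \<open>prod_sset X (Delta UNIV)\<close>. In dimension at least 2 only the degenerate simplices are kept.
  This is the 1-dimensional simplicial set with the prescribed simplices in dimensions 0 and 1: a
  non-degenerate edge of it stays non-degenerate in the product, hence distinct
  degenerate simplices are represented by distinct pairs.\<close>

fun total_space_simp :: "'x sset \<Rightarrow> ('x \<Rightarrow> nat) \<Rightarrow> nat \<Rightarrow> ('x \<times> nat list) set" where
  "total_space_simp X m 0 = {(x, [i]) | x i. x \<in> simp X 0 \<and> i < m x}"
| "total_space_simp X m (Suc 0) =
     {(\<sigma>, [i, j]) | \<sigma> i j. \<sigma> \<in> simp X 1 \<and> i < m (face X 1 1 \<sigma>) \<and> j < m (face X 1 0 \<sigma>)}"
| "total_space_simp X m (Suc (Suc k)) =
     {degen (prod_sset X (Delta UNIV)) (Suc k) j e | j e. j \<le> Suc k \<and> e \<in> total_space_simp X m (Suc k)}"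

definition total_space :: "'x sset \<Rightarrow> ('x \<Rightarrow> nat) \<Rightarrow> ('x \<times> nat list) sset" where
  "total_space X m =
     \<lparr>simp = total_space_simp X m,
      face = face (prod_sset X (Delta UNIV)),
      degen = degen (prod_sset X (Delta UNIV))\<rparr>"

definition bundle_map :: "nat \<Rightarrow> 'x \<times> nat list \<Rightarrow> 'x" where
  "bundle_map k = fst"

text \<open>The inclusion $E(X,\vec m) \hookrightarrow X \times \Delta_{\mathbb{Z}_d}$ over $X$ sends
  $(\sigma,(i,j))$ to $(\sigma,(i,j))$; in the present encoding it does not change the pair.\<close>

definition incl :: "nat \<Rightarrow> 'x \<times> nat list \<Rightarrow> 'x \<times> nat list" where
  "incl k e = e"

section \<open>Cycle distributions\<close>

definition cycle_distribution_Delta ::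
    "nat \<Rightarrow> nat \<Rightarrow> nat \<Rightarrow> (nat \<Rightarrow> circ \<Rightarrow> nat list \<Rightarrow> real) \<Rightarrow> bool" where
  "cycle_distribution_Delta n d k p \<longleftrightarrow>
     simplicial_map (circle n) (D (Delta {..<d})) p \<and> 1 \<le> k \<and> k \<le> d \<and>
     (\<exists>a :: nat \<Rightarrow> nat \<Rightarrow> nat.
        (\<forall>i\<in>{1..n}. \<forall>j\<in>{1..k}. a i j < d) \<and>
        (\<forall>i\<in>{1..n}. \<forall>j\<in>{1..k}. \<forall>s\<in>{1..k}. j \<noteq> s \<longrightarrow> a i j \<noteq> a i s) \<and>
        (\<forall>i\<in>{1..<n}. \<forall>x<d. \<forall>y<d.
           p 1 (circle_edge i) [x, y] =
             (if \<exists>j\<in>{1..k}. (x, y) = (a i j, a (i + 1) j) then 1 / real k else 0)) \<and>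
        (\<forall>x<d. \<forall>y<d.
           p 1 (circle_edge n) [x, y] =
             (if (\<exists>j\<in>{1..<k}. (x, y) = (a n j, a 1 (j + 1))) \<or> (x, y) = (a n k, a 1 1)
              then 1 / real k else 0)))"

text \<open>$i_*(p) = D(i) \circ p$, followed by the identification of simplicial distributions on
  $\mathrm{pr}_1$ with maps into $D(\Delta_{\mathbb{Z}_d})$ via the second projection.\<close>

definition cycle_distribution ::
    "nat \<Rightarrow> (circ \<Rightarrow> nat) \<Rightarrow> nat \<Rightarrow> (nat \<Rightarrow> circ \<Rightarrow> circ \<times> nat list \<Rightarrow> real) \<Rightarrow> bool" where
  "cycle_distribution n m k p \<longleftrightarrow>
     p \<in> sDist (total_space (circle n) m) (circle n) bundle_map \<and>
     cycle_distribution_Delta n (Max (m ` simp (circle n) 0)) k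
       (\<lambda>l x. push snd (push (incl l) (p l x)))"

section \<open>Well-definedness\<close>

lemma simplicial_setI:
  assumes "\<And>k x i. x \<in> simp X (Suc k) \<Longrightarrow> i \<le> Suc k \<Longrightarrow> face X (Suc k) i x \<in> simp X k"
    and "\<And>k x j. x \<in> simp X k \<Longrightarrow> j \<le> k \<Longrightarrow> degen X k j x \<in> simp X (Suc k)"
    and "\<And>k x i j. x \<in> simp X (Suc (Suc k)) \<Longrightarrow> j \<le> Suc (Suc k) \<Longrightarrow> i < j \<Longrightarrow>
        face X (Suc k) i (face X (Suc (Suc k)) j x)
          = face X (Suc k) (j - 1) (face X (Suc (Suc k)) i x)"
    and "\<And>k x i j. x \<in> simp X k \<Longrightarrow> j \<le> k \<Longrightarrow> i \<le> j \<Longrightarrow>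
        degen X (Suc k) i (degen X k j x) = degen X (Suc k) (Suc j) (degen X k i x)"
    and "\<And>k x i j. x \<in> simp X k \<Longrightarrow> j \<le> k \<Longrightarrow> i \<le> Suc k \<Longrightarrow>
        face X (Suc k) i (degen X k j x) =
          (if i < j then degen X (k - 1) (j - 1) (face X k i x)
           else if i \<le> Suc j then x
           else degen X (k - 1) j (face X k (i - 1) x))"
  shows "simplicial_set X"
  using assms unfolding simplicial_set_def by (intro conjI allI ballI impI)

lemma simplicial_setD:
  assumes "simplicial_set X"
  shows "x \<in> simp X (Suc k) \<Longrightarrow> i \<le> Suc k \<Longrightarrow> face X (Suc k) i x \<in> simp X k"
    and "x \<in> simp X k \<Longrightarrow> j \<le> k \<Longrightarrow> degen X k j x \<in> simp X (Suc k)"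
    and "x \<in> simp X k \<Longrightarrow> j \<le> k \<Longrightarrow> i \<le> Suc k \<Longrightarrow>
        face X (Suc k) i (degen X k j x) =
          (if i < j then degen X (k - 1) (j - 1) (face X k i x)
           else if i \<le> Suc j then x
           else degen X (k - 1) j (face X k (i - 1) x))"
    and "x \<in> simp X (Suc (Suc k)) \<Longrightarrow> j \<le> Suc (Suc k) \<Longrightarrow> i < j \<Longrightarrow>
        face X (Suc k) i (face X (Suc (Suc k)) j x)
          = face X (Suc k) (j - 1) (face X (Suc (Suc k)) i x)"
    and "x \<in> simp X k \<Longrightarrow> j \<le> k \<Longrightarrow> i \<le> j \<Longrightarrow>
        degen X (Suc k) i (degen X k j x) = degen X (Suc k) (Suc j) (degen X k i x)"
  using assms unfolding simplicial_set_def by simp_all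

lemma simplicial_set_prod_sset:
  assumes "simplicial_set X" "simplicial_set Y"
  shows "simplicial_set (prod_sset X Y)"
  using assms unfolding simplicial_set_def prod_sset_def by (auto simp: mem_Times_iff)

lemma delete_nth:
  "i < length xs \<Longrightarrow> length (delete_nth i xs) = length xs - 1"
  "i < length xs \<Longrightarrow> t < length xs - 1 \<Longrightarrow>
     delete_nth i xs ! t = xs ! (if t < i then t else Suc t)"
  "set (delete_nth i xs) \<subseteq> set xs"
  by (auto simp: delete_nth_def nth_append min_def dest: in_set_takeD in_set_dropD)

lemma repeat_nth:
  "j < length xs \<Longrightarrow> length (repeat_nth j xs) = Suc (length xs)"
  "j < length xs \<Longrightarrow> t \<le> length xs \<Longrightarrow>
     repeat_nth j xs ! t = xs ! (if t \<le> j then t else t - 1)"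
  "set (repeat_nth j xs) \<subseteq> set xs"
  by (auto simp: repeat_nth_def nth_append min_def intro: arg_cong dest: in_set_takeD in_set_dropD)

lemma simplicial_set_Delta: "simplicial_set (Delta U)"
proof (rule simplicial_setI, unfold Delta_def sset.simps mem_Collect_eq)
  note nths = delete_nth(1,2) repeat_nth(1,2)
  show "length (delete_nth i x) = Suc k \<and> set (delete_nth i x) \<subseteq> U"
    if "length x = Suc (Suc k) \<and> set x \<subseteq> U" "i \<le> Suc k" for k x i
    using that delete_nth(3)[of i x] by (auto simp: nths)
  show "length (repeat_nth j x) = Suc (Suc k) \<and> set (repeat_nth j x) \<subseteq> U"
    if "length x = Suc k \<and> set x \<subseteq> U" "j \<le> k" for k x j
    using that repeat_nth(3)[of j x] by (auto simp: nths)
  show "delete_nth i (delete_nth j x) = delete_nth (j - 1) (delete_nth i x)"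
    if "length x = Suc (Suc (Suc k)) \<and> set x \<subseteq> U" "j \<le> Suc (Suc k)" "i < j" for k x i j
    using that by (intro nth_equalityI) (auto simp: nths)
  show "repeat_nth i (repeat_nth j x) = repeat_nth (Suc j) (repeat_nth i x)"
    if "length x = Suc k \<and> set x \<subseteq> U" "j \<le> k" "i \<le> j" for k x i j
    using that by (intro nth_equalityI) (auto simp: nths)
  show "delete_nth i (repeat_nth j x) =
      (if i < j then repeat_nth (j - 1) (delete_nth i x)
       else if i \<le> Suc j then x else repeat_nth j (delete_nth (i - 1) x))"
    if "length x = Suc k \<and> set x \<subseteq> U" "j \<le> k" "i \<le> Suc k" for k x i j
    using that by (intro nth_equalityI)
      (auto simp: nths Suc_diff_le intro!: arg_cong[where f = "(!) x"])
qed

lemma circle_simps: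
  "Vert i \<in> simp (circle n) k \<longleftrightarrow> 1 \<le> i \<and> i \<le> n"
  "Edge i c \<in> simp (circle n) k \<longleftrightarrow> 1 \<le> i \<and> i \<le> n \<and> 1 \<le> c \<and> c \<le> k"
  "face (circle n) = circle_face n" "degen (circle n) = circle_degen"
  by (auto simp: circle_def)

lemma simplicial_set_circle: "simplicial_set (circle n)"
proof (rule simplicial_setI, unfold circle_simps(3,4))
  show "circle_face n (Suc k) i x \<in> simp (circle n) k"
    if "x \<in> simp (circle n) (Suc k)" "i \<le> Suc k" for k i x
    using that by (cases x) (auto simp: circle_simps circle_succ_def)
  show "circle_degen k j x \<in> simp (circle n) (Suc k)"
    if "x \<in> simp (circle n) k" for k j x
    using that by (cases x) (auto simp: circle_simps)
  show "circle_face n (Suc k) i (circle_face n (Suc (Suc k)) j x)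
      = circle_face n (Suc k) (j - 1) (circle_face n (Suc (Suc k)) i x)"
    if "x \<in> simp (circle n) (Suc (Suc k))" "j \<le> Suc (Suc k)" "i < j" for k i j x
    using that by (cases x) (auto simp: circle_simps)
  show "circle_degen (Suc k) i (circle_degen k j x)
      = circle_degen (Suc k) (Suc j) (circle_degen k i x)"
    if "x \<in> simp (circle n) k" "j \<le> k" "i \<le> j" for k i j x
    using that by (cases x) auto
  show "circle_face n (Suc k) i (circle_degen k j x) =
          (if i < j then circle_degen (k - 1) (j - 1) (circle_face n k i x)
           else if i \<le> Suc j then x
           else circle_degen (k - 1) j (circle_face n k (i - 1) x))"
    if "x \<in> simp (circle n) k" "j \<le> k" "i \<le> Suc k" for k i j x
    using that by (cases x) (auto simp: circle_simps)
qed

lemma nondegenerate_circle: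
  "nondegenerate (circle n) 0 = Vert ` {1..n}"
  "nondegenerate (circle n) 1 = circle_edge ` {1..n}"
  "nondegenerate (circle n) (Suc (Suc k)) = {}"
proof -
  show "nondegenerate (circle n) 0 = Vert ` {1..n}"
    by (auto simp: nondegenerate_def circle_def)
  show "nondegenerate (circle n) 1 = circle_edge ` {1..n}"
    by (auto simp: nondegenerate_def circle_def circle_edge_def)
  have "\<exists>j\<le>Suc k. \<exists>y\<in>simp (circle n) (Suc k). x = degen (circle n) (Suc k) j y"
    if x: "x \<in> simp (circle n) (Suc (Suc k))" for x
  proof (cases x)
    case (Vert i)
    then show ?thesis using x by (intro exI[of _ 0]) (auto simp: circle_def intro!: bexI[of _ x])
  next
    case (Edge i c)
    show ?thesis
    proof (cases "c = 1")
      case True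
      then show ?thesis using x Edge
        by (intro exI[of _ "Suc k"]) (auto simp: circle_def intro!: bexI[of _ "Edge i 1"])
    next
      case False
      then show ?thesis using x Edge
        by (intro exI[of _ 0]) (auto simp: circle_def intro!: bexI[of _ "Edge i (c - 1)"])
    qed
  qed
  then show "nondegenerate (circle n) (Suc (Suc k)) = {}"
    by (auto simp: nondegenerate_def)
qed

lemma total_space_simp_subset:
  assumes "simplicial_set X" and "\<And>x. x \<in> simp X 0 \<Longrightarrow> {..<m x} \<subseteq> U"
  shows "total_space_simp X m k \<subseteq> simp (prod_sset X (Delta U)) k"
  using assms
proof (induction X m k rule: total_space_simp.induct)
  case (1 X m)
  then show ?case by (fastforce simp: prod_sset_def Delta_def delete_nth_def repeat_nth_def)
next
  case (2 X m)
  have "face X 1 i \<sigma> \<in> simp X 0" if "\<sigma> \<in> simp X 1" "i \<le> 1" for i \<sigma>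
    using simplicial_setD(1)[OF 2(1), of \<sigma> 0 i] that by simp
  then have "{..<m (face X 1 i \<sigma>)} \<subseteq> U" if "\<sigma> \<in> simp X 1" "i \<le> 1" for i \<sigma>
    using 2(2) that by blast
  from this[of _ 0] this[of _ 1] show ?case
    by (auto simp: prod_sset_def Delta_def subset_eq)
next
  case (3 X m k)
  have P: "simplicial_set (prod_sset X (Delta U))"
    using 3 by (intro simplicial_set_prod_sset simplicial_set_Delta)
  have "degen (prod_sset X (Delta UNIV)) = degen (prod_sset X (Delta U))"
    by (simp add: prod_sset_def Delta_def)
  then show ?case using 3 simplicial_setD(2)[OF P] by fastforce
qed

lemma total_space_closed:
  assumes X: "simplicial_set X"
  shows "e \<in> total_space_simp X m k \<Longrightarrow> j \<le> k \<Longrightarrow>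
      degen (prod_sset X (Delta UNIV)) k j e \<in> total_space_simp X m (Suc k)"
    and "e \<in> total_space_simp X m (Suc k) \<Longrightarrow> i \<le> Suc k \<Longrightarrow>
      face (prod_sset X (Delta UNIV)) (Suc k) i e \<in> total_space_simp X m k"
proof -
  let ?P = "prod_sset X (Delta (UNIV :: nat set))"
  have P: "simplicial_set ?P"
    using X by (intro simplicial_set_prod_sset simplicial_set_Delta)
  show deg: "degen ?P k j e \<in> total_space_simp X m (Suc k)"
    if ek: "e \<in> total_space_simp X m k" "j \<le> k" for e k j
  proof (cases k)
    case 0
    then obtain x i where e: "e = (x, [i])" "x \<in> simp X 0" "i < m x"
      using ek by auto
    then show ?thesis
      using 0 ek simplicial_setD(2)[OF X, of x 0 0] simplicial_setD(3)[OF X, of x 0 0]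
      by (auto simp: prod_sset_def Delta_def delete_nth_def repeat_nth_def)
  next
    case (Suc l)
    then show ?thesis using ek by (simp only: total_space_simp.simps) blast
  qed
  show "face ?P (Suc k) i e \<in> total_space_simp X m k"
    if "e \<in> total_space_simp X m (Suc k)" "i \<le> Suc k"
    using that
  proof (induction k arbitrary: e i)
    case 0
    then obtain \<sigma> a b where e: "e = (\<sigma>, [a, b])" "\<sigma> \<in> simp X 1"
        "a < m (face X 1 1 \<sigma>)" "b < m (face X 1 0 \<sigma>)"
      by auto
    moreover have "i = 0 \<or> i = 1" using 0 by auto
    ultimately show ?case
      using simplicial_setD(1)[OF X, of \<sigma> 0 i] by (auto simp: prod_sset_def Delta_def delete_nth_def repeat_nth_def)
  next
    case (Suc k)
    then obtain j e' where e: "e = degen ?P (Suc k) j e'" "j \<le> Suc k"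
        "e' \<in> total_space_simp X m (Suc k)"
      by auto
    have "e' \<in> simp ?P (Suc k)"
      using total_space_simp_subset[OF X, where U = UNIV and m = m] e(3) by blast
    then have "face ?P (Suc (Suc k)) i e =
        (if i < j then degen ?P k (j - 1) (face ?P (Suc k) i e')
         else if i \<le> Suc j then e'
         else degen ?P k j (face ?P (Suc k) (i - 1) e'))"
      using simplicial_setD(3)[OF P, of e' "Suc k" j i] e Suc.prems by simp
    then show ?case using Suc.IH[OF e(3)] Suc.prems(2) e(2,3)
      by (auto intro!: deg simp del: total_space_simp.simps)
  qed
qed

lemma simplicial_set_total_space:
  assumes "simplicial_set X"
  shows "simplicial_set (total_space X m)"
proof -
  let ?P = "prod_sset X (Delta (UNIV :: nat set))"
  have P: "simplicial_set ?P"
    using assms by (intro simplicial_set_prod_sset simplicial_set_Delta)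
  have sub: "e \<in> simp ?P k" if "e \<in> total_space_simp X m k" for e k
    using total_space_simp_subset[OF assms, where U = UNIV and m = m] that by blast
  show ?thesis
    using P total_space_closed[OF assms, where m = m]
    unfolding simplicial_set_def total_space_def by (auto dest!: sub simp del: total_space_simp.simps)
qed

lemma simplicial_map_bundle_map:
  assumes "simplicial_set X"
  shows "simplicial_map (total_space X m) X bundle_map"
  using total_space_simp_subset[OF assms, where U = UNIV and m = m]
  unfolding simplicial_map_def total_space_def bundle_map_def
  by (fastforce simp: prod_sset_def simp del: total_space_simp.simps)

lemma simplicial_map_incl:
  assumes "simplicial_set X" "\<And>x. x \<in> simp X 0 \<Longrightarrow> m x \<le> d"
  shows "simplicial_map (total_space X m) (prod_sset X (Delta {..<d})) incl"
proof -
  have "total_space_simp X m k \<subseteq> simp (prod_sset X (Delta {..<d})) k" for k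
    using assms by (intro total_space_simp_subset) fastforce+
  then show ?thesis
    unfolding simplicial_map_def total_space_def incl_def
    by (auto simp: prod_sset_def Delta_def simp del: total_space_simp.simps)
qed

lemma distributions_push:
  assumes p: "p \<in> distributions U" and f: "\<And>u. u \<in> U \<Longrightarrow> f u \<in> V"
  shows "push f p \<in> distributions V"
proof -
  let ?S = "{u. p u \<noteq> 0}"
  have S: "finite ?S" "?S \<subseteq> U" "\<And>u. 0 \<le> p u" "sum p ?S = 1"
    using p by (auto simp: distributions_def)
  have supp: "{v. push f p v \<noteq> 0} \<subseteq> f ` ?S"
  proof
    fix v assume "v \<in> {v. push f p v \<noteq> 0}"
    then have "{u. p u \<noteq> 0 \<and> f u = v} \<noteq> {}" by (auto simp: push_def simp del: Collect_empty_eq)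
    then show "v \<in> f ` ?S" by auto
  qed
  have "(\<Sum>v | push f p v \<noteq> 0. push f p v) = (\<Sum>v\<in>f ` ?S. push f p v)"
    using supp S(1) by (intro sum.mono_neutral_left) auto
  also have "\<dots> = sum p ?S"
    using sum.group[OF S(1) finite_imageI[OF S(1)] order_refl, of p f] by (simp add: push_def)
  finally have "(\<Sum>v | push f p v \<noteq> 0. push f p v) = 1" using S(4) by simp
  moreover have "finite {v. push f p v \<noteq> 0}" "{v. push f p v \<noteq> 0} \<subseteq> V"
    using supp S(1,2) f by (auto intro: finite_subset)
  moreover have "0 \<le> push f p v" for v
    unfolding push_def using S(3) by (simp add: sum_nonneg)
  ultimately show ?thesis by (simp add: distributions_def)
qed

lemma push_push:
  assumes p: "p \<in> distributions U"
  shows "push g (push f p) = push (\<lambda>u. g (f u)) p"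
proof
  fix w
  let ?S = "{u. p u \<noteq> 0}"
  have S: "finite ?S" using p by (auto simp: distributions_def)
  let ?T = "{v \<in> f ` ?S. g v = w}"
  have "push g (push f p) w = (\<Sum>v\<in>?T. push f p v)"
    unfolding push_def[of g]
  proof (rule sum.mono_neutral_left)
    show "finite ?T" using S by simp
    have "v \<in> f ` ?S" if "push f p v \<noteq> 0" for v
    proof -
      from that have "{u. p u \<noteq> 0 \<and> f u = v} \<noteq> {}" by (auto simp: push_def simp del: Collect_empty_eq)
      then show ?thesis by auto
    qed
    then show "{u. push f p u \<noteq> 0 \<and> g u = w} \<subseteq> ?T" by auto
  qed auto
  also have "\<dots> = (\<Sum>v\<in>?T. \<Sum>u | u \<in> {u. p u \<noteq> 0 \<and> g (f u) = w} \<and> f u = v. p u)"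
    by (intro sum.cong) (auto simp: push_def intro!: sum.cong)
  also have "\<dots> = push (\<lambda>u. g (f u)) p w"
    unfolding push_def using S by (intro sum.group) auto
  finally show "push g (push f p) w = push (\<lambda>u. g (f u)) p w" .
qed

lemma push_cong:
  assumes "p \<in> distributions U" "\<And>u. u \<in> U \<Longrightarrow> f u = g u"
  shows "push f p = push g p"
  using assms unfolding push_def distributions_def
  by (intro ext sum.cong) auto

lemma push_ident: "push (\<lambda>u. u) p = p"
proof
  fix v
  have "{u. p u \<noteq> 0 \<and> u = v} = (if p v = 0 then {} else {v})" by auto
  then show "push (\<lambda>u. u) p v = p v" by (simp add: push_def)
qed

lemma simplicial_set_D:
  assumes Y: "simplicial_set Y"
  shows "simplicial_set (D Y)"
proof -
  have sd: "simp (D Y) k = distributions (simp Y k)" "face (D Y) k i = push (face Y k i)"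
    "degen (D Y) k i = push (degen Y k i)" for k i
    by (simp_all add: D_def)
  show ?thesis
  proof (rule simplicial_setI, unfold sd)
  show "push (face Y (Suc k) i) p \<in> distributions (simp Y k)"
    if "p \<in> distributions (simp Y (Suc k))" "i \<le> Suc k" for k i p
    using that simplicial_setD(1,2)[OF Y] by (intro distributions_push)
  show "push (degen Y k j) p \<in> distributions (simp Y (Suc k))"
    if "p \<in> distributions (simp Y k)" "j \<le> k" for k j p
    using that simplicial_setD(1,2)[OF Y] by (intro distributions_push)
  show "push (face Y (Suc k) i) (push (face Y (Suc (Suc k)) j) p)
      = push (face Y (Suc k) (j - 1)) (push (face Y (Suc (Suc k)) i) p)"
    if "p \<in> distributions (simp Y (Suc (Suc k)))" "j \<le> Suc (Suc k)" "i < j" for k i j p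
    using that(2,3) unfolding push_push[OF that(1)]
    by (intro push_cong[OF that(1)] simplicial_setD(4,5)[OF Y])
  show "push (degen Y (Suc k) i) (push (degen Y k j) p)
      = push (degen Y (Suc k) (Suc j)) (push (degen Y k i) p)"
    if "p \<in> distributions (simp Y k)" "j \<le> k" "i \<le> j" for k i j p
    using that(2,3) unfolding push_push[OF that(1)]
    by (intro push_cong[OF that(1)] simplicial_setD(4,5)[OF Y])
  show "push (face Y (Suc k) i) (push (degen Y k j) p) =
          (if i < j then push (degen Y (k - 1) (j - 1)) (push (face Y k i) p)
           else if i \<le> Suc j then p
           else push (degen Y (k - 1) j) (push (face Y k (i - 1)) p))"
    if p: "p \<in> distributions (simp Y k)" "j \<le> k" "i \<le> Suc k" for k i j p
  proof -
    have "push (face Y (Suc k) i) (push (degen Y k j) p)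
        = push (\<lambda>u. if i < j then degen Y (k - 1) (j - 1) (face Y k i u)
           else if i \<le> Suc j then u
           else degen Y (k - 1) j (face Y k (i - 1) u)) p"
      using simplicial_setD(3)[OF Y] p(2,3)
      unfolding push_push[OF p(1)] by (intro push_cong[OF p(1)]) simp
    then show ?thesis
      by (simp add: push_push[OF p(1)] push_ident)
  qed
  qed
qed

end

theory Submission
  imports Defs
begin

text \<open>A simplicial distribution on \<open>f_m\<close> is determined by its values on the edges \<open>\<sigma>_i\<close>, and these form
  a circulation of total mass 1 through each layer of the layered cyclic graph whose nodes are the pairs
  \<open>(v_i, a)\<close>. The support of a circulation contains a simple directed cycle, and the uniform
  circulation on a simple cycle is the only one supported there; so the vertices are exactly the
  uniform circulations on simple cycles. A simple cycle that winds \<open>k\<close> times around the circle carries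
  a section in its support only if \<open>k = 1\<close>, and in that case the circulation is deterministic.\<close>

section \<open>Push-forwards\<close>

text \<open>Every node of a simple cycle has one incoming and one outgoing cycle edge. Conservation
  therefore makes a circulation supported there constant along the cycle, and total mass 1 leaves no
  freedom. A cycle winding \<open>k\<close> times has \<open>k\<close> edges over each
  \<open>\<sigma>_i\<close>, whence the weight 1/k.

  The obstacle is bookkeeping. In the family \<open>a_i^(j)\<close> the upper index changes only
  when \<open>\<sigma>_n\<close> is crossed, and for \<open>n = 1\<close> the only edge of the base
  is a loop. A cycle is therefore treated as a periodic sequence in time, whose layer is the time
  modulo \<open>n\<close>: all steps then look alike, and the special form of
  \<open>\<sigma>_n\<close> reappears only in the translation to the definition of a cycle
  distribution. Degenerate simplices matter only in the passage between simplicial distributions and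
  circulations.\<close>

lemma push_neq_0:
  assumes p: "p \<in> distributions U" and u: "p u \<noteq> 0"
  shows "0 < push f p (f u)"
proof -
  have "p u \<le> push f p (f u)"
    unfolding push_def using p u by (intro member_le_sum) (auto simp: distributions_def)
  then show ?thesis using p u by (simp add: distributions_def) (metis order_less_le order_less_le_trans)
qed

lemma push_eqI:
  assumes "\<And>v. p v \<noteq> 0 \<Longrightarrow> f v = w \<Longrightarrow> v = u" and "f u = w"
  shows "push f p w = p u"
proof (cases "p u = 0")
  case True
  then have "{v. p v \<noteq> 0 \<and> f v = w} = {}" using assms by blast
  then show ?thesis using True by (simp only: push_def) simp
next
  case False
  then have "{v. p v \<noteq> 0 \<and> f v = w} = {u}" using assms by blast
  then show ?thesis by (simp add: push_def)
qed

lemma push_eq_0: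
  assumes "\<And>v. p v \<noteq> 0 \<Longrightarrow> f v \<noteq> w"
  shows "push f p w = 0"
proof -
  have "{v. p v \<noteq> 0 \<and> f v = w} = {}" using assms by blast
  then show ?thesis by (simp only: push_def) simp
qed

lemma push_const:
  assumes "p \<in> distributions U"
  shows "push (\<lambda>_. x) p = delta x"
  using assms by (auto simp: push_def delta_def distributions_def)

lemma push_delta: "push f (delta u) = delta (f u)"
proof
  fix w
  have "{v. delta u v \<noteq> 0 \<and> f v = w} = (if f u = w then {u} else {})"
    by (auto simp: delta_def)
  then show "push f (delta u) w = delta (f u) w" by (simp add: push_def delta_def)
qed

lemma delta_in_distributions: "delta u \<in> distributions U \<longleftrightarrow> u \<in> U"
  by (auto simp: distributions_def delta_def)

lemma delta_inject: "delta u = delta v \<longleftrightarrow> u = v"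
  by (metis delta_def zero_neq_one)

lemma push_linear:
  assumes "q \<in> distributions U" "r \<in> distributions V"
  shows "push f (\<lambda>u. a * q u + b * r u) = (\<lambda>v. a * push f q v + b * push f r v)"
proof
  fix v
  \<comment> \<open>The coefficients may have opposite signs, so cancellation can shrink the support
    of the combination; all three sums are taken over the union of the supports.\<close>
  let ?T = "{u. (q u \<noteq> 0 \<or> r u \<noteq> 0) \<and> f u = v}"
  have T: "finite ?T"
    using assms by (intro finite_subset[of ?T "{u. q u \<noteq> 0} \<union> {u. r u \<noteq> 0}"]) (auto simp: distributions_def)
  have "push f (\<lambda>u. a * q u + b * r u) v = (\<Sum>u\<in>?T. a * q u + b * r u)"
    unfolding push_def using T by (intro sum.mono_neutral_left) auto
  moreover have "push f q v = (\<Sum>u\<in>?T. q u)" "push f r v = (\<Sum>u\<in>?T. r u)"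
    unfolding push_def using T by (auto intro!: sum.mono_neutral_left)
  ultimately show "push f (\<lambda>u. a * q u + b * r u) v = a * push f q v + b * push f r v"
    by (simp add: sum.distrib sum_distrib_left)
qed

lemma distributions_sum:
  assumes "p \<in> distributions U" "finite A" "\<And>u. p u \<noteq> 0 \<Longrightarrow> u \<in> A"
  shows "sum p A = 1"
proof -
  have "sum p A = sum p {u. p u \<noteq> 0}"
    using assms by (intro sum.mono_neutral_right) auto
  then show ?thesis using assms by (simp add: distributions_def)
qed

lemma distributionsI:
  assumes "finite A" "A \<subseteq> U" "\<And>u. p u \<noteq> 0 \<Longrightarrow> u \<in> A" "\<And>u. 0 \<le> p u" "sum p A = 1"
  shows "p \<in> distributions U"
proof -
  have supp: "{u. p u \<noteq> 0} \<subseteq> A" using assms(3) by blast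
  have "sum p {u. p u \<noteq> 0} = sum p A"
    using assms(1) supp by (intro sum.mono_neutral_left) auto
  then show ?thesis
    using supp assms(2,4,5) finite_subset[OF supp assms(1)] by (simp add: distributions_def)
qed

text \<open>Masses are nonnegative, so mass outside the fibre could not cancel in the
  push-forward.\<close>

lemma distributions_fiber:
  assumes p: "p \<in> distributions U" and f: "push f p = delta x"
  shows "p \<in> distributions {u \<in> U. f u = x}"
proof -
  have "f u = x" if "p u \<noteq> 0" for u
    using push_neq_0[OF p that, of f] f by (simp add: delta_def split: if_splits)
  then show ?thesis using p by (auto simp: distributions_def)
qed

section \<open>Simplicial maps\<close>

lemma simplicial_mapD:
  assumes "simplicial_map X Y f"
  shows "x \<in> simp X k \<Longrightarrow> f k x \<in> simp Y k"
    and "x \<in> simp X (Suc k) \<Longrightarrow> i \<le> Suc k \<Longrightarrow> f k (face X (Suc k) i x) = face Y (Suc k) i (f (Suc k) x)"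
    and "x \<in> simp X k \<Longrightarrow> j \<le> k \<Longrightarrow> f (Suc k) (degen X k j x) = degen Y k j (f k x)"
  using assms unfolding simplicial_map_def by auto

lemma simplicial_mapI:
  assumes "\<And>x k. x \<in> simp X k \<Longrightarrow> f k x \<in> simp Y k"
    and "\<And>x k i. x \<in> simp X (Suc k) \<Longrightarrow> i \<le> Suc k \<Longrightarrow> f k (face X (Suc k) i x) = face Y (Suc k) i (f (Suc k) x)"
    and "\<And>x k j. x \<in> simp X k \<Longrightarrow> j \<le> k \<Longrightarrow> f (Suc k) (degen X k j x) = degen Y k j (f k x)"
  shows "simplicial_map X Y f"
  using assms unfolding simplicial_map_def by auto

lemma simplicial_map_comp:
  assumes "simplicial_map X Y f" "simplicial_map Y Z g"
  shows "simplicial_map X Z (\<lambda>k x. g k (f k x))"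
  using assms by (auto simp: simplicial_map_def)

lemma D_simps:
  "simp (D Y) k = distributions (simp Y k)"
  "face (D Y) k i = push (face Y k i)"
  "degen (D Y) k i = push (degen Y k i)"
  by (simp_all add: D_def)

lemma simplicial_map_push:
  assumes f: "simplicial_map X Y f"
  shows "simplicial_map (D X) (D Y) (\<lambda>k. push (f k))"
proof (rule simplicial_mapI, unfold D_simps)
  show "push (f k) p \<in> distributions (simp Y k)" if "p \<in> distributions (simp X k)" for p k
    using that simplicial_mapD(1)[OF f] by (rule distributions_push)
  show "push (f k) (push (face X (Suc k) i) p) = push (face Y (Suc k) i) (push (f (Suc k)) p)"
    if p: "p \<in> distributions (simp X (Suc k))" and "i \<le> Suc k" for p k i
    unfolding push_push[OF p] using p simplicial_mapD(2)[OF f] that(2) by (intro push_cong) auto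
  show "push (f (Suc k)) (push (degen X k j) p) = push (degen Y k j) (push (f k) p)"
    if p: "p \<in> distributions (simp X k)" and "j \<le> k" for p k j
    unfolding push_push[OF p] using p simplicial_mapD(3)[OF f] that(2) by (intro push_cong) auto
qed

text \<open>The value at a degenerate simplex is forced by a value one dimension lower, so induction
  on the dimension leaves only nondegenerate simplices.\<close>

lemma simplicial_map_eqI:
  assumes f: "simplicial_map X Y f" and g: "simplicial_map X Y g"
    and eq: "\<And>k x. x \<in> nondegenerate X k \<Longrightarrow> f k x = g k x"
  shows "x \<in> simp X k \<Longrightarrow> f k x = g k x"
proof (induction k arbitrary: x)
  case 0
  then show ?case by (intro eq) (auto simp: nondegenerate_def)
next
  case (Suc k)
  show ?case
  proof (cases "x \<in> nondegenerate X (Suc k)")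
    case True
    then show ?thesis by (rule eq)
  next
    case False
    then obtain j y where "j \<le> k" "y \<in> simp X k" "x = degen X k j y"
      using Suc.prems by (auto simp: nondegenerate_def)
    then show ?thesis
      using simplicial_mapD(3)[OF f] simplicial_mapD(3)[OF g] Suc.IH by simp
  qed
qed

section \<open>Simplicial distributions on the circle as circulations\<close>

fun base_index :: "circ \<Rightarrow> nat" where
  "base_index (Vert i) = i"
| "base_index (Edge i c) = i"

text \<open>\<open>Edge i c\<close> has its first \<open>c\<close> vertices over the source of
  \<open>\<sigma>_i\<close> and the others over its target, hence the two constant blocks of labels.
  One pair \<open>u\<close> thus labels all degeneracies of \<open>\<sigma>_i\<close>, whatever
  their dimension.\<close>

fun labelled :: "nat \<Rightarrow> circ \<Rightarrow> nat \<times> nat \<Rightarrow> circ \<times> nat list" where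
  "labelled k (Vert i) u = (Vert i, replicate (Suc k) (fst u))"
| "labelled k (Edge i c) u = (Edge i c, replicate c (fst u) @ replicate (Suc k - c) (snd u))"

abbreviation label_pairs :: "nat \<Rightarrow> (circ \<Rightarrow> nat) \<Rightarrow> nat \<Rightarrow> (nat \<times> nat) set" where
  "label_pairs n m i \<equiv> {..<m (Vert i)} \<times> {..<m (Vert (circle_succ n i))}"

abbreviation circle_bundle :: "nat \<Rightarrow> (circ \<Rightarrow> nat) \<Rightarrow> (circ \<times> nat list) sset" where
  "circle_bundle n m \<equiv> total_space (circle n) m"

lemma total_space_simps:
  "simp (total_space X m) = total_space_simp X m"
  "face (total_space X m) k i (x, xs) = (face X k i x, delete_nth i xs)"
  "degen (total_space X m) k i (x, xs) = (degen X k i x, repeat_nth i xs)"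
  by (simp_all add: total_space_def prod_sset_def Delta_def)

lemma circle_succ_range: "1 \<le> i \<Longrightarrow> i \<le> n \<Longrightarrow> circle_succ n i \<in> {1..n}"
  by (auto simp: circle_succ_def)

lemma degen_labelled:
  assumes "x \<in> simp (circle n) k" "j \<le> k"
  shows "degen (circle_bundle n m) k j (labelled k x u) = labelled (Suc k) (circle_degen k j x) u"
  using assms
  by (cases x)
    (auto simp: total_space_simps circle_simps repeat_nth nth_append simp del: replicate_Suc
      intro!: nth_equalityI)

text \<open>On a vertex \<open>labelled\<close> reads only the first label, so the second label 0 below is arbitrary.\<close>

lemma face_labelled:
  assumes "x \<in> simp (circle n) (Suc k)" "i \<le> Suc k"
  shows "face (circle_bundle n m) (Suc k) i (labelled (Suc k) x u)
    = (if i = 0 \<and> (\<exists>l. x = Edge l 1) then labelled k (circle_face n (Suc k) i x) (snd u, 0)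
       else labelled k (circle_face n (Suc k) i x) u)"
  using assms
  by (cases x)
    (auto simp: total_space_simps circle_simps delete_nth nth_append simp del: replicate_Suc
      intro!: nth_equalityI)

lemma labelled_in_total_space:
  assumes "x \<in> simp (circle n) k" "u \<in> label_pairs n m (base_index x)"
  shows "labelled k x u \<in> total_space_simp (circle n) m k"
  using assms
proof (induction k arbitrary: x)
  case 0
  then show ?case by (cases x) (auto simp: circle_simps)
next
  case (Suc k)
  show ?case
  proof (cases k)
    case 0
    then show ?thesis using Suc.prems by (cases x; cases u) (auto simp: circle_simps)
  next
    case (Suc l)
    \<comment> \<open>From dimension 2 on the total space is built by degeneracies alone, so
      membership is obtained by writing \<open>x\<close> as a degeneracy.\<close>
    then obtain j y where y: "j \<le> k" "y \<in> simp (circle n) k" "x = degen (circle n) k j y"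
      using nondegenerate_circle(3)[of n l] Suc.prems(1) unfolding nondegenerate_def by blast
    have "base_index x = base_index y" using y(3) by (cases y) (auto simp: circle_simps)
    then have "labelled k y u \<in> total_space_simp (circle n) m k"
      using Suc.IH y(2) Suc.prems(2) by simp
    from simplicial_setD(2)[OF simplicial_set_total_space[OF simplicial_set_circle], unfolded total_space_simps, OF this y(1)]
    show ?thesis using degen_labelled[OF y(2,1)] y(3) by (simp add: circle_simps)
  qed
qed

text \<open>The second clause is conservation of flow at the labels over the vertex shared by two
  consecutive edges. For \<open>n = 1\<close> it equates the two marginals of a single
  distribution.\<close>

definition circulation :: "nat \<Rightarrow> (circ \<Rightarrow> nat) \<Rightarrow> (nat \<Rightarrow> nat \<times> nat \<Rightarrow> real) \<Rightarrow> bool" where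
  "circulation n m P \<longleftrightarrow> (\<forall>i\<in>{1..n}. P i \<in> distributions (label_pairs n m i) \<and>
     push snd (P i) = push fst (P (circle_succ n i)))"

text \<open>A vertex receives the first marginal of its outgoing edge.\<close>

definition of_edges :: "(nat \<Rightarrow> nat \<times> nat \<Rightarrow> real) \<Rightarrow> nat \<Rightarrow> circ \<Rightarrow> circ \<times> nat list \<Rightarrow> real" where
  "of_edges P k x = push (labelled k x) (P (base_index x))"

definition edge_prob :: "(nat \<Rightarrow> circ \<Rightarrow> circ \<times> nat list \<Rightarrow> real) \<Rightarrow> nat \<Rightarrow> nat \<times> nat \<Rightarrow> real" where
  "edge_prob p i = push (\<lambda>e. (hd (snd e), last (snd e))) (p 1 (circle_edge i))"

lemma base_index_range: "x \<in> simp (circle n) k \<Longrightarrow> base_index x \<in> {1..n}"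
  by (cases x) (auto simp: circle_simps)

lemma of_edges_sDist:
  assumes P: "circulation n m P"
  shows "of_edges P \<in> sDist (circle_bundle n m) (circle n) bundle_map"
proof -
  have dist: "P (base_index x) \<in> distributions (label_pairs n m (base_index x))"
    if "x \<in> simp (circle n) k" for x k
    using P base_index_range[OF that] by (auto simp: circulation_def)
  have "simplicial_map (circle n) (D (circle_bundle n m)) (of_edges P)"
  proof (rule simplicial_mapI, unfold D_simps)
    show "of_edges P k x \<in> distributions (simp (circle_bundle n m) k)"
      if x: "x \<in> simp (circle n) k" for x k
      unfolding of_edges_def total_space_simps
      using labelled_in_total_space[OF x] by (rule distributions_push[OF dist[OF x]])
    show "of_edges P (Suc k) (degen (circle n) k j x) = push (degen (circle_bundle n m) k j) (of_edges P k x)"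
      if x: "x \<in> simp (circle n) k" and j: "j \<le> k" for x k j
    proof -
      have "base_index (degen (circle n) k j x) = base_index x"
        by (cases x) (auto simp: circle_simps)
      then show ?thesis
        unfolding of_edges_def push_push[OF dist[OF x]] using degen_labelled[OF x j]
        by (simp add: circle_simps)
    qed
    show "of_edges P k (face (circle n) (Suc k) i x) = push (face (circle_bundle n m) (Suc k) i) (of_edges P (Suc k) x)"
      if x: "x \<in> simp (circle n) (Suc k)" and i: "i \<le> Suc k" for x k i
    proof (cases "i = 0 \<and> (\<exists>l. x = Edge l 1)")
      \<comment> \<open>The only faces that need conservation: \<open>d_0\<close> removes the one
        vertex over the source of \<open>\<sigma>_l\<close>, so the face lies over the target, where
        \<open>of_edges\<close> reads the next edge instead of \<open>\<sigma>_l\<close>.\<close>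
      case True
      then obtain l where l: "x = Edge l 1" "i = 0" by blast
      then have ln: "l \<in> {1..n}" using x by (auto simp: circle_simps)
      let ?s = "circle_succ n l"
      have s: "?s \<in> {1..n}" using circle_succ_range ln by auto
      note d = P[unfolded circulation_def, rule_format, OF ln, THEN conjunct1]
        P[unfolded circulation_def, rule_format, OF s, THEN conjunct1]
      have "of_edges P k (face (circle n) (Suc k) i x) = push (\<lambda>a. labelled k (Vert ?s) (a, 0)) (push fst (P ?s))"
      proof -
        have "labelled k (Vert ?s) = (\<lambda>u. labelled k (Vert ?s) (fst u, 0))" by auto
        then show ?thesis
          using l unfolding push_push[OF d(2)] by (simp add: of_edges_def circle_simps del: labelled.simps)
      qed
      also have "\<dots> = push (\<lambda>a. labelled k (Vert ?s) (a, 0)) (push snd (P l))"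
        using P ln by (simp add: circulation_def)
      also have "\<dots> = push (face (circle_bundle n m) (Suc k) i) (of_edges P (Suc k) x)"
        unfolding of_edges_def push_push[OF dist[OF x]] push_push[OF d(1)]
        unfolding face_labelled[OF x i] using l by simp
      finally show ?thesis .
    next
      case False
      then have "base_index (face (circle n) (Suc k) i x) = base_index x"
        by (cases x) (auto simp: circle_simps)
      then show ?thesis
        unfolding of_edges_def push_push[OF dist[OF x]] unfolding face_labelled[OF x i] using False
        by (auto simp: circle_simps)
    qed
  qed
  moreover have "push (bundle_map k) (of_edges P k x) = delta x" if x: "x \<in> simp (circle n) k" for k x
  proof -
    have "bundle_map k (labelled k x u) = x" for u by (cases x) (auto simp: bundle_map_def)
    then show ?thesis
      unfolding of_edges_def push_push[OF dist[OF x]] using push_const[OF dist[OF x]] by simp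
  qed
  ultimately show ?thesis by (simp add: sDist_def)
qed

lemma sDist_edge:
  assumes p: "p \<in> sDist (circle_bundle n m) (circle n) bundle_map" and i: "i \<in> {1..n}"
  shows "p 1 (circle_edge i) \<in> distributions (labelled 1 (circle_edge i) ` label_pairs n m i)"
proof -
  have e: "circle_edge i \<in> simp (circle n) 1" using i by (simp add: circle_edge_def circle_simps)
  have "p 1 (circle_edge i) \<in> distributions {e \<in> total_space_simp (circle n) m 1. bundle_map 1 e = circle_edge i}"
    using p e by (intro distributions_fiber) (auto simp: sDist_def D_simps total_space_simps dest: simplicial_mapD(1))
  moreover have "{e \<in> total_space_simp (circle n) m 1. bundle_map 1 e = circle_edge i}
      \<subseteq> labelled 1 (circle_edge i) ` label_pairs n m i"
    by (force simp: bundle_map_def circle_edge_def circle_simps)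
  ultimately show ?thesis by (auto simp: distributions_def)
qed

text \<open>Over an edge the label list consists of its two ends, which \<open>hd\<close> and
  \<open>last\<close> recover. Together with \<open>edge_prob_of_edges\<close> this makes the two
  passages inverse to each other.\<close>

lemma of_edges_edge_prob_edge:
  assumes p: "p \<in> sDist (circle_bundle n m) (circle n) bundle_map" and i: "i \<in> {1..n}"
  shows "of_edges (edge_prob p) 1 (circle_edge i) = p 1 (circle_edge i)"
proof -
  note d = sDist_edge[OF p i]
  have "of_edges (edge_prob p) 1 (circle_edge i)
      = push (\<lambda>e. labelled 1 (circle_edge i) (hd (snd e), last (snd e))) (p 1 (circle_edge i))"
    unfolding of_edges_def edge_prob_def by (simp add: circle_edge_def push_push[OF d[unfolded circle_edge_def One_nat_def]]
        del: labelled.simps)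
  also have "\<dots> = push (\<lambda>e. e) (p 1 (circle_edge i))"
    by (rule push_cong[OF d]) (auto simp: circle_edge_def)
  finally show ?thesis by (simp add: push_ident)
qed

lemma edge_prob_of_edges:
  assumes "circulation n m P" "i \<in> {1..n}"
  shows "edge_prob (of_edges P) i = P i"
proof -
  have d: "P i \<in> distributions (label_pairs n m i)" using assms by (simp add: circulation_def)
  show ?thesis
    unfolding edge_prob_def of_edges_def circle_edge_def base_index.simps push_push[OF d] by (simp add: push_ident)
qed

text \<open>Both marginals are the distribution at the shared vertex, which is \<open>d_0\<close> of
  one edge and \<open>d_1\<close> of the next.\<close>

lemma circulation_edge_prob:
  assumes p: "p \<in> sDist (circle_bundle n m) (circle n) bundle_map"
  shows "circulation n m (edge_prob p)"
  unfolding circulation_def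
proof (intro ballI conjI)
  note sm = p[unfolded sDist_def, simplified, THEN conjunct1]
  fix i assume i: "i \<in> {1..n}"
  note d = sDist_edge[OF p i]
  show P: "edge_prob p i \<in> distributions (label_pairs n m i)"
    unfolding edge_prob_def by (rule distributions_push[OF d]) (auto simp: circle_edge_def)
  let ?s = "circle_succ n i"
  have s: "?s \<in> {1..n}" using circle_succ_range i by auto
  note d' = sDist_edge[OF p s]
  have e: "circle_edge l \<in> simp (circle n) (Suc 0)" if "l \<in> {1..n}" for l
    using that by (simp add: circle_edge_def circle_simps)
  have v: "p 0 (Vert ?s) = push (face (circle_bundle n m) (Suc 0) 0) (p 1 (circle_edge i))"
    using simplicial_mapD(2)[OF sm e[OF i], of 0] by (simp add: D_simps circle_simps circle_edge_def)
  have v': "p 0 (Vert ?s) = push (face (circle_bundle n m) (Suc 0) 1) (p 1 (circle_edge ?s))"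
    using simplicial_mapD(2)[OF sm e[OF s], of 1] by (simp add: D_simps circle_simps circle_edge_def)
  have "push snd (edge_prob p i) = push (\<lambda>e. hd (snd e)) (p 0 (Vert ?s))"
    unfolding edge_prob_def v push_push[OF d]
    by (rule push_cong[OF d]) (auto simp: circle_edge_def total_space_simps delete_nth_def)
  also have "\<dots> = push fst (edge_prob p ?s)"
    unfolding edge_prob_def v' push_push[OF d']
    by (rule push_cong[OF d']) (auto simp: circle_edge_def total_space_simps delete_nth_def)
  finally show "push snd (edge_prob p i) = push fst (edge_prob p ?s)" .
qed

lemma sDist_eqI:
  assumes p: "p \<in> sDist (circle_bundle n m) (circle n) bundle_map"
    and q: "q \<in> sDist (circle_bundle n m) (circle n) bundle_map"
    and eq: "\<And>i. i \<in> {1..n} \<Longrightarrow> p 1 (circle_edge i) = q 1 (circle_edge i)"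
    and x: "x \<in> simp (circle n) k"
  shows "p k x = q k x"
proof -
  have sm: "simplicial_map (circle n) (D (circle_bundle n m)) p" "simplicial_map (circle n) (D (circle_bundle n m)) q"
    using p q by (auto simp: sDist_def)
  show ?thesis
  proof (rule simplicial_map_eqI[OF sm _ x])
    fix k x assume x: "x \<in> nondegenerate (circle n) k"
    have "k = 0 \<or> k = 1 \<or> (\<exists>l. k = Suc (Suc l))" by (metis One_nat_def not0_implies_Suc)
    then show "p k x = q k x"
    proof (elim disjE exE)
      assume k: "k = 0"
      then obtain i where i: "i \<in> {1..n}" "x = Vert i" using x nondegenerate_circle(1) by auto
      then have e: "circle_edge i \<in> simp (circle n) (Suc 0)"
        by (simp add: circle_edge_def circle_simps)
      \<comment> \<open>Each vertex is the source of an edge, so agreement on edges passes to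
        vertices.\<close>
      have "Vert i = face (circle n) (Suc 0) 1 (circle_edge i)"
        by (simp add: circle_edge_def circle_simps)
      then show ?thesis
        using simplicial_mapD(2)[OF sm(1) e, of 1] simplicial_mapD(2)[OF sm(2) e, of 1] eq[OF i(1)] k i(2) by simp
    next
      assume k: "k = 1"
      then show ?thesis using x nondegenerate_circle(2) eq by auto
    next
      fix l assume "k = Suc (Suc l)"
      then show ?thesis using x nondegenerate_circle(3) by auto
    qed
  qed
qed

lemma sDist_eq_of_edges:
  assumes p: "p \<in> sDist (circle_bundle n m) (circle n) bundle_map"
    and P: "circulation n m P" and eq: "\<And>i. i \<in> {1..n} \<Longrightarrow> edge_prob p i = P i"
    and x: "x \<in> simp (circle n) k"
  shows "p k x = of_edges P k x"
proof (rule sDist_eqI[OF p of_edges_sDist[OF P] _ x])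
  fix i assume i: "i \<in> {1..n}"
  show "p 1 (circle_edge i) = of_edges P 1 (circle_edge i)"
    using of_edges_edge_prob_edge[OF p i] eq[OF i] by (simp add: of_edges_def circle_edge_def)
qed

section \<open>Cycles in the support of a circulation\<close>

abbreviation layer :: "nat \<Rightarrow> nat \<Rightarrow> nat" where
  "layer n t \<equiv> Suc (t mod n)"

text \<open>A simple cycle of order \<open>k\<close> is listed as a periodic sequence \<open>c\<close> of labels starting in layer 1:
  the node at time \<open>t\<close> is \<open>(v_i, c t)\<close> with \<open>i = layer n t\<close>, so that
  \<open>a_i^(j) = c (n * (j - 1) + (i - 1))\<close>.\<close>

definition cycle_walk :: "nat \<Rightarrow> nat \<Rightarrow> (nat \<Rightarrow> nat) \<Rightarrow> bool" where
  "cycle_walk n k c \<longleftrightarrow> 1 \<le> k \<and> (\<forall>t. c (t + n * k) = c t) \<and>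
     (\<forall>s t. s mod n = t mod n \<longrightarrow> c s = c t \<longrightarrow> s mod (n * k) = t mod (n * k))"

text \<open>Asking for some time \<open>t\<close> counts an edge once although the walk traverses it
  in every period.\<close>

definition cycle_prob :: "nat \<Rightarrow> nat \<Rightarrow> (nat \<Rightarrow> nat) \<Rightarrow> nat \<Rightarrow> nat \<times> nat \<Rightarrow> real" where
  "cycle_prob n k c i u = (if \<exists>t. layer n t = i \<and> u = (c t, c (Suc t)) then 1 / real k else 0)"

section \<open>Arithmetic of layers and periodic walks\<close>

lemma circle_succ_layer: "n \<ge> 1 \<Longrightarrow> circle_succ n (layer n t) = layer n (Suc t)"
  by (auto simp: circle_succ_def mod_Suc)

lemma layer_range: "n \<ge> 1 \<Longrightarrow> layer n t \<in> {1..n}"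
  by (simp add: Suc_le_eq)

lemma Suc_mod_cancel: "Suc s mod d = Suc t mod d \<longleftrightarrow> s mod d = t mod (d::nat)"
  by (auto simp: mod_Suc split: if_splits)

lemma cycle_walk_mod:
  assumes "cycle_walk n k c"
  shows "c (t mod (n * k)) = c t"
proof -
  have "c (r + n * k * j) = c r" for r j
  proof (induction j)
    case (Suc j)
    have "c (r + n * k * Suc j) = c ((r + n * k * j) + n * k)" by (simp add: algebra_simps)
    also have "\<dots> = c (r + n * k * j)" using assms unfolding cycle_walk_def by blast
    finally show ?case using Suc.IH by (rule trans)
  qed simp
  from this[of "t mod (n * k)" "t div (n * k)"] show ?thesis by simp
qed

lemma cycle_walk_distinct:
  assumes "cycle_walk n k c" "layer n s = layer n t" "c s = c t"
  shows "s mod (n * k) = t mod (n * k)"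
  using assms unfolding cycle_walk_def by blast

text \<open>A node of a simple cycle determines the time modulo the period, hence both its successor
  and its predecessor. This is the form in which simplicity is used below.\<close>

lemma cycle_walk_Suc:
  assumes "cycle_walk n k c" "layer n s = layer n t"
  shows "c (Suc s) = c (Suc t) \<longleftrightarrow> c s = c t"
proof
  have l: "layer n (Suc s) = layer n (Suc t)" using assms(2) Suc_mod_cancel by simp
  assume "c (Suc s) = c (Suc t)"
  then have "s mod (n * k) = t mod (n * k)"
    using cycle_walk_distinct[OF assms(1) l] unfolding Suc_mod_cancel by blast
  then show "c s = c t" using cycle_walk_mod[OF assms(1)] by metis
next
  assume "c s = c t"
  then have "Suc s mod (n * k) = Suc t mod (n * k)"
    using cycle_walk_distinct[OF assms] unfolding Suc_mod_cancel by blast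
  then show "c (Suc s) = c (Suc t)" using cycle_walk_mod[OF assms(1)] by metis
qed

lemma cycle_prob_neq_0:
  "cycle_walk n k c \<Longrightarrow> cycle_prob n k c i u \<noteq> 0 \<longleftrightarrow> (\<exists>t. layer n t = i \<and> u = (c t, c (Suc t)))"
  by (auto simp: cycle_prob_def cycle_walk_def)

text \<open>Time \<open>n * j + (i - 1)\<close> is the visit to layer \<open>i\<close> during turn
  \<open>j\<close>; turns and times count from 0, layers from 1.\<close>

lemma cycle_index:
  assumes "i \<in> {1..n}"
  shows "layer n (n * j + (i - 1)) = i" and "j < k \<Longrightarrow> n * j + (i - 1) < n * k"
proof -
  have i: "i - 1 < n" using assms by auto
  then show "layer n (n * j + (i - 1)) = i"
    unfolding mod_mult_self4 using assms by simp
  assume "j < k"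
  have "n * j + (i - 1) < n * Suc j" using i by simp
  also have "\<dots> \<le> n * k" using \<open>j < k\<close> by (intro mult_le_mono2) simp
  finally show "n * j + (i - 1) < n * k" .
qed

lemma cycle_walk_edges:
  assumes n: "n \<ge> 1" and c: "cycle_walk n k c" and i: "i \<in> {1..n}"
  shows "(\<exists>t. layer n t = i \<and> u = (c t, c (Suc t)))
    \<longleftrightarrow> (\<exists>j<k. u = (c (n * j + (i - 1)), c (Suc (n * j + (i - 1)))))"
proof
  assume "\<exists>t. layer n t = i \<and> u = (c t, c (Suc t))"
  then obtain t where t: "layer n t = i" "u = (c t, c (Suc t))" by blast
  have k: "k \<ge> 1" using c unfolding cycle_walk_def by blast
  \<comment> \<open>Reduce \<open>t\<close> to the first period; the turn is then the quotient by
    \<open>n\<close>.\<close>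
  define r where "r = t mod (n * k)"
  have "r < n * k" using n k by (simp add: r_def)
  then have rk: "r div n < k" by (simp add: less_mult_imp_div_less mult.commute)
  have r: "layer n r = i" using t(1) by (simp add: r_def mod_mod_cancel)
  then have "r = n * (r div n) + (i - 1)" by auto
  moreover have "c r = c t" using cycle_walk_mod[OF c] by (simp add: r_def)
  moreover have "c (Suc r) = c (Suc t)"
    using \<open>c r = c t\<close> cycle_walk_Suc[OF c, of r t] r t(1) by simp
  ultimately show "\<exists>j<k. u = (c (n * j + (i - 1)), c (Suc (n * j + (i - 1))))"
    using rk t(2) by metis
next
  assume "\<exists>j<k. u = (c (n * j + (i - 1)), c (Suc (n * j + (i - 1))))"
  then show "\<exists>t. layer n t = i \<and> u = (c t, c (Suc t))"
    using cycle_index(1)[OF i] by blast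
qed

section \<open>Circulations supported on a single cycle\<close>

lemma push_snd_cycle_supported:
  assumes "cycle_walk n k c" "\<And>u. Q u \<noteq> 0 \<Longrightarrow> cycle_prob n k c (layer n t) u \<noteq> 0"
  shows "push snd Q (c (Suc t)) = Q (c t, c (Suc t))"
proof (rule push_eqI)
  fix v assume v: "Q v \<noteq> 0" "snd v = c (Suc t)"
  then obtain s where s: "layer n s = layer n t" "v = (c s, c (Suc s))"
    using assms(2)[OF v(1)] unfolding cycle_prob_neq_0[OF assms(1)] by blast
  then show "v = (c t, c (Suc t))" using cycle_walk_Suc[OF assms(1) s(1)] v(2) by simp
qed simp

lemma push_fst_cycle_supported:
  assumes "cycle_walk n k c" "\<And>u. Q u \<noteq> 0 \<Longrightarrow> cycle_prob n k c (layer n t) u \<noteq> 0"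
  shows "push fst Q (c t) = Q (c t, c (Suc t))"
proof (rule push_eqI)
  fix v assume v: "Q v \<noteq> 0" "fst v = c t"
  then obtain s where s: "layer n s = layer n t" "v = (c s, c (Suc s))"
    using assms(2)[OF v(1)] unfolding cycle_prob_neq_0[OF assms(1)] by blast
  then show "v = (c t, c (Suc t))" using cycle_walk_Suc[OF assms(1) s(1)] v(2) by simp
qed simp

lemma circulation_cycle_prob:
  assumes n: "n \<ge> 1" and c: "cycle_walk n k c" and m: "\<And>t. c t < m (Vert (layer n t))"
  shows "circulation n m (cycle_prob n k c)"
  unfolding circulation_def
proof (intro ballI conjI)
  have k: "k \<ge> 1" using c unfolding cycle_walk_def by blast
  fix i assume i: "i \<in> {1..n}"
  define e where "e j = n * j + (i - 1)" for j
  have e: "layer n (e j) = i" "j < k \<Longrightarrow> e j < n * k" for j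
    unfolding e_def using cycle_index[OF i] by blast+
  let ?A = "(\<lambda>j. (c (e j), c (Suc (e j)))) ` {..<k}"
  \<comment> \<open>The \<open>k\<close> turns give \<open>k\<close> different edges over
    \<open>\<sigma>_i\<close>, so the weights 1/k add up to 1.\<close>
  have "inj_on (\<lambda>j. (c (e j), c (Suc (e j)))) {..<k}"
  proof (rule inj_onI)
    fix j j' assume j: "j \<in> {..<k}" "j' \<in> {..<k}"
      and "(c (e j), c (Suc (e j))) = (c (e j'), c (Suc (e j')))"
    then have "e j mod (n * k) = e j' mod (n * k)"
      using cycle_walk_distinct[OF c, of "e j" "e j'"] e(1) by simp
    then show "j = j'" using e(2)[of j] e(2)[of j'] j n by (simp add: e_def)
  qed
  then have card: "card ?A = k" by (simp add: card_image)
  show "cycle_prob n k c i \<in> distributions (label_pairs n m i)"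
  proof (rule distributionsI)
    show "finite ?A" by simp
    show "?A \<subseteq> label_pairs n m i"
    proof
      fix u assume "u \<in> ?A"
      then obtain j where "u = (c (e j), c (Suc (e j)))" by blast
      then show "u \<in> label_pairs n m i"
        using m[of "e j"] m[of "Suc (e j)"] e(1)[of j] circle_succ_layer[OF n, of "e j"] by simp
    qed
    show "u \<in> ?A" if u: "cycle_prob n k c i u \<noteq> 0" for u
      using u cycle_walk_edges[OF n c i, of u] unfolding cycle_prob_neq_0[OF c] e_def by blast
    show "0 \<le> cycle_prob n k c i u" for u by (simp add: cycle_prob_def)
    have "sum (cycle_prob n k c i) ?A = (\<Sum>u\<in>?A. 1 / real k)"
      using e(1) by (intro sum.cong) (auto simp: cycle_prob_def)
    then show "sum (cycle_prob n k c i) ?A = 1" using card k by simp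
  qed
  show "push snd (cycle_prob n k c i) = push fst (cycle_prob n k c (circle_succ n i))"
  proof
    fix y
    show "push snd (cycle_prob n k c i) y = push fst (cycle_prob n k c (circle_succ n i)) y"
    proof (cases "\<exists>t. layer n t = i \<and> y = c (Suc t)")
      case True
      then obtain t where t: "i = layer n t" "y = c (Suc t)" by blast
      show ?thesis
        unfolding t circle_succ_layer[OF n]
        by (subst push_snd_cycle_supported[OF c], assumption, subst push_fst_cycle_supported[OF c], assumption)
          (auto simp: cycle_prob_def)
    next
      case False
      have "c t \<noteq> y" if "layer n t = circle_succ n i" for t
      proof
        assume y: "c t = y"
        have "0 < n * k" using n k by simp
        \<comment> \<open>Time 0 has no earlier time, so the predecessor of the node is taken one
          period later.\<close>
        then obtain s where s: "Suc s = t + n * k" by (metis add_gr_0 gr0_implies_Suc)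
        have "c (Suc s) = c t" unfolding s using c unfolding cycle_walk_def by blast
        then have "c (Suc s) = y" using y by simp
        moreover have "layer n (Suc s) = layer n t" by (simp add: s)
        then have "circle_succ n (layer n s) = circle_succ n i"
          using that circle_succ_layer[OF n, of s] by simp
        then have "layer n s = i"
          using layer_range[OF n, of s] i by (auto simp: circle_succ_def split: if_splits)
        ultimately show False using False by blast
      qed
      then have "push fst (cycle_prob n k c (circle_succ n i)) y = 0"
        by (intro push_eq_0) (metis cycle_prob_neq_0[OF c] fst_conv)
      moreover have "push snd (cycle_prob n k c i) y = 0"
        using False by (intro push_eq_0) (auto simp: cycle_prob_neq_0[OF c])
      ultimately show ?thesis by simp
    qed
  qed
qed

text \<open>At each cycle node inflow and outflow are carried by single edges, so conservation makes
  the edge weight constant in time; comparing total masses then fixes it.\<close>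

lemma circulation_supported_on_cycle:
  assumes n: "n \<ge> 1" and c: "cycle_walk n k c"
    and P: "circulation n m (cycle_prob n k c)" and Q: "circulation n m' Q"
    and supp: "\<And>i u. i \<in> {1..n} \<Longrightarrow> Q i u \<noteq> 0 \<Longrightarrow> cycle_prob n k c i u \<noteq> 0"
    and i: "i \<in> {1..n}"
  shows "Q i = cycle_prob n k c i"
proof -
  define g where "g t = Q (layer n t) (c t, c (Suc t))" for t
  have s: "Q (layer n t) u \<noteq> 0 \<Longrightarrow> cycle_prob n k c (layer n t) u \<noteq> 0" for t u
    using supp layer_range[OF n] by blast
  have "push snd (Q (layer n t)) (c (Suc t)) = g t" for t
    unfolding g_def by (rule push_snd_cycle_supported[OF c]) (rule s)
  moreover have "push fst (Q (layer n t)) (c t) = g t" for t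
    unfolding g_def by (rule push_fst_cycle_supported[OF c]) (rule s)
  moreover have "push snd (Q (layer n t)) = push fst (Q (layer n (Suc t)))" for t
    using Q layer_range[OF n, of t] circle_succ_layer[OF n, of t] by (simp add: circulation_def)
  ultimately have "g (Suc t) = g t" for t by metis
  then have g: "g t = g 0" for t by (induction t) auto
  have k: "k \<ge> 1" using c unfolding cycle_walk_def by blast
  \<comment> \<open>The factor is the quotient of the constant weight \<open>g 0\<close> of
    \<open>Q\<close> by the weight 1/k of the cycle.\<close>
  have eq: "Q i u = g 0 * real k * cycle_prob n k c i u" for u
  proof (cases "cycle_prob n k c i u = 0")
    case True
    then have "Q i u = 0" using supp[OF i] by blast
    then show ?thesis using True by simp
  next
    case False
    then obtain t where t: "layer n t = i" "u = (c t, c (Suc t))"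
      unfolding cycle_prob_neq_0[OF c] by blast
    then have "cycle_prob n k c i u = 1 / real k" by (auto simp: cycle_prob_def)
    moreover have "Q i u = g t" using t by (simp add: g_def)
    ultimately show ?thesis using k g[of t] by simp
  qed
  let ?A = "{u. cycle_prob n k c i u \<noteq> 0}"
  have d: "cycle_prob n k c i \<in> distributions (label_pairs n m i)" "Q i \<in> distributions (label_pairs n m' i)"
    using P Q i by (auto simp: circulation_def)
  then have A: "finite ?A" by (simp add: distributions_def)
  have "sum (cycle_prob n k c i) ?A = 1" by (rule distributions_sum[OF d(1) A]) simp
  moreover have "sum (Q i) ?A = 1" by (rule distributions_sum[OF d(2) A]) (simp add: supp[OF i])
  ultimately have "g 0 * real k = 1" by (simp add: eq flip: sum_distrib_left)
  then show ?thesis by (intro ext) (simp add: eq)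
qed

text \<open>A section inside the support follows the walk, and hence closes up after a single turn.\<close>

lemma cycle_walk_no_section:
  assumes n: "n \<ge> 1" and c: "cycle_walk n k c" and k: "k \<ge> 2"
    and s: "\<And>i. i \<in> {1..n} \<Longrightarrow> cycle_prob n k c i (s i, s (circle_succ n i)) \<noteq> 0"
  shows False
proof -
  have st: "\<exists>t. layer n t = layer n r \<and> s (layer n r) = c t \<and> s (layer n (Suc r)) = c (Suc t)" for r
    using s[OF layer_range[OF n, of r]] unfolding cycle_prob_neq_0[OF c] circle_succ_layer[OF n] by blast
  from st[of 0] obtain t where t: "layer n t = layer n 0" "s (layer n 0) = c t" by blast
  have "s (layer n (t + r)) = c (t + r)" for r
  proof (induction r)
    case 0
    then show ?case using t by simp
  next
    case (Suc r)
    obtain t' where t': "layer n t' = layer n (t + r)" "s (layer n (t + r)) = c t'"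
        "s (layer n (Suc (t + r))) = c (Suc t')"
      using st by blast
    then show ?case using Suc cycle_walk_Suc[OF c t'(1)] by simp
  qed
  from this[of n] this[of 0] have "c (t + n) = c t" by simp
  then have "(t + n) mod (n * k) = t mod (n * k)"
    by (intro cycle_walk_distinct[OF c]) auto
  then have "n * k dvd n" using mod_eq_dvd_iff_nat[of t "t + n" "n * k"] by simp
  then have "n * k \<le> n" using n by (intro dvd_imp_le) auto
  then show False using n k by simp
qed

section \<open>Existence of a cycle in the support\<close>

lemma circulation_infinite_walk:
  assumes n: "n \<ge> 1" and P: "circulation n m P"
  obtains w where "\<And>t. P (layer n t) (w t, w (Suc t)) \<noteq> 0"
proof -
  have d: "P (layer n t) \<in> distributions (label_pairs n m (layer n t))" for t
    using P layer_range[OF n, of t] by (simp add: circulation_def)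
  have "\<exists>f. \<forall>t. P (layer n t) (f t) \<noteq> 0 \<and> snd (f t) = fst (f (Suc t))"
  proof (rule dependent_nat_choice)
    have "{u. P (layer n 0) u \<noteq> 0} \<noteq> {}"
    proof
      assume "{u. P (layer n 0) u \<noteq> 0} = {}"
      then have "sum (P (layer n 0)) {u. P (layer n 0) u \<noteq> 0} = 0" by (simp only: sum.empty)
      then show False using d[of 0] by (simp add: distributions_def)
    qed
    then show "\<exists>u. P (layer n 0) u \<noteq> 0" by blast
  next
    fix u t assume u: "P (layer n t) u \<noteq> 0"
    have "push snd (P (layer n t)) = push fst (P (layer n (Suc t)))"
      using P layer_range[OF n, of t] circle_succ_layer[OF n, of t] by (simp add: circulation_def)
    \<comment> \<open>By conservation the label just reached has positive mass under the next edge,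
      so the walk never gets stuck.\<close>
    then have "push fst (P (layer n (Suc t))) (snd u) \<noteq> 0"
      using push_neq_0[OF d u, of snd] by simp
    then show "\<exists>v. P (layer n (Suc t)) v \<noteq> 0 \<and> snd u = fst v"
      using push_eq_0 by metis
  qed
  then obtain f where f: "\<And>t. P (layer n t) (f t) \<noteq> 0" "\<And>t. snd (f t) = fst (f (Suc t))" by blast
  have "f t = (fst (f t), fst (f (Suc t)))" for t using f(2) by (simp flip: f(2))
  then show ?thesis using that[of "\<lambda>t. fst (f t)"] f(1) by metis
qed

text \<open>A shortest closed subwalk of an infinite walk in the support visits no node twice.\<close>

lemma circulation_contains_cycle:
  assumes n: "n \<ge> 1" and P: "circulation n m P"
  obtains k c where "cycle_walk n k c" "\<And>t. P (layer n t) (c t, c (Suc t)) \<noteq> 0"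
proof -
  obtain w where w: "\<And>t. P (layer n t) (w t, w (Suc t)) \<noteq> 0"
    using circulation_infinite_walk[OF n P] by blast
  \<comment> \<open>Requiring \<open>n dvd K\<close> makes equal labels mean equal nodes: the walk
    has returned to the same layer.\<close>
  define closed where "closed K \<longleftrightarrow> 0 < K \<and> n dvd K \<and> (\<exists>s. w (s + K) = w s)" for K
  have "\<exists>K. closed K"
  proof -
    \<comment> \<open>Pigeonhole: the times \<open>n * j\<close> all lie in layer 1, where finitely
      many labels are available.\<close>
    have "w (n * j) \<in> {..<m (Vert 1)}" for j
    proof -
      have "P 1 \<in> distributions (label_pairs n m 1)" using P n by (simp add: circulation_def)
      moreover have "P 1 (w (n * j), w (Suc (n * j))) \<noteq> 0" using w[of "n * j"] by simp
      ultimately show ?thesis by (auto simp: distributions_def)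
    qed
    then have "range (\<lambda>j. w (n * j)) \<subseteq> {..<m (Vert 1)}" by blast
    then have "\<not> inj (\<lambda>j. w (n * j))"
      using finite_subset finite_imageD infinite_UNIV_nat by blast
    then obtain i j where ij: "w (n * i) = w (n * j)" "i < j" by (metis injI linorder_neqE_nat)
    then have "n * i + n * (j - i) = n * j" by (simp add: diff_mult_distrib2)
    then have "closed (n * (j - i))" using ij n unfolding closed_def by (intro conjI exI[of _ "n * i"]) auto
    then show ?thesis by blast
  qed
  define K where "K = (LEAST K. closed K)"
  have K: "closed K" unfolding K_def using \<open>\<exists>K. closed K\<close> by (rule LeastI_ex)
  have min: "K \<le> L" if "closed L" for L unfolding K_def using that by (rule Least_le)
  obtain k where k: "K = n * k" using K by (auto simp: closed_def)
  obtain s where s: "w (s + K) = w s" using K by (auto simp: closed_def)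
  \<comment> \<open>Position inside the closed block of \<open>w\<close> that starts at
    \<open>s\<close>. The shift is chosen because \<open>s + s * (n - 1)\<close> is a multiple of
    \<open>n\<close>, so the block is re-timed to start in layer 1.\<close>
  define q where "q t = (t + s * (n - 1)) mod K" for t
  have q: "q t < K" for t using K by (simp add: q_def closed_def)
  have layer: "layer n (s + q t) = layer n t" for t
  proof -
    have "(s + q t) mod n = (s + (t + s * (n - 1))) mod n"
      unfolding q_def k by (metis mod_add_right_eq mod_mod_cancel dvd_triv_left)
    also have "s + (t + s * (n - 1)) = t + s * n" using n by (cases n) auto
    finally show ?thesis by simp
  qed
  define c where "c t = w (s + q t)" for t
  \<comment> \<open>At the end of the block \<open>q\<close> jumps back to 0, which is harmless
    because \<open>w (s + K) = w s\<close>.\<close>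
  have Suc: "c (Suc t) = w (Suc (s + q t))" for t
  proof -
    have "q (Suc t) = (if Suc (q t) = K then 0 else Suc (q t))" by (simp add: q_def mod_Suc)
    then show ?thesis using s by (auto simp: c_def)
  qed
  \<comment> \<open>Otherwise the part of the block between the two visits would be a shorter closed
    walk. The other inequality follows by symmetry.\<close>
  have distinct: "q t \<le> q t'" if eq: "t mod n = t' mod n" "c t = c t'" for t t'
  proof (rule ccontr)
    assume less: "\<not> q t \<le> q t'"
    have "(s + q t) mod n = (s + q t') mod n" using layer[of t] layer[of t'] eq(1) by simp
    then have "n dvd q t - q t'" using less mod_eq_dvd_iff_nat[of "s + q t'" "s + q t" n] by simp
    moreover have "w (s + q t' + (q t - q t')) = w (s + q t')" using less eq(2) by (simp add: c_def)
    moreover have "0 < q t - q t'" using less by simp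
    ultimately have "closed (q t - q t')" unfolding closed_def by blast
    then show False using min q[of t] less by fastforce
  qed
  have "cycle_walk n k c"
    unfolding cycle_walk_def
  proof (intro conjI allI impI)
    show "1 \<le> k" using K k by (cases k) (auto simp: closed_def)
    have "q (t + n * k) = q t" for t
    proof -
      have "t + n * k + s * (n - 1) = t + s * (n - 1) + K" using k by simp
      then show ?thesis unfolding q_def by (simp only: mod_add_self2)
    qed
    then show "c (t + n * k) = c t" for t by (simp add: c_def)
    fix t t' assume "t mod n = t' mod n" "c t = c t'"
    then have "q t = q t'" using distinct[of t t'] distinct[of t' t] by simp
    then show "t mod (n * k) = t' mod (n * k)"
      unfolding q_def k[symmetric] by (simp add: nat_mod_eq_iff)
  qed
  moreover have "P (layer n t) (c t, c (Suc t)) \<noteq> 0" for t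
    using w[of "s + q t"] layer[of t] Suc[of t] by (simp add: c_def)
  ultimately show ?thesis by (rule that)
qed

section \<open>Deterministic and noncontextual distributions\<close>

text \<open>Point masses are natural under push-forward and determine their points, so the equations
  satisfied by \<open>p\<close> descend to \<open>\<phi>\<close>.\<close>

lemma deterministicI:
  assumes X: "simplicial_set X" and p: "p \<in> sDist E X f"
    and eq: "\<And>k x. x \<in> simp X k \<Longrightarrow> p k x = delta (\<phi> k x)"
  shows "deterministic E X f p"
proof -
  note sm = p[unfolded sDist_def, simplified, THEN conjunct1]
  have "simplicial_map X E \<phi>"
  proof (rule simplicial_mapI)
    show "\<phi> k x \<in> simp E k" if "x \<in> simp X k" for x k
      using simplicial_mapD(1)[OF sm that] eq[OF that] by (simp add: D_simps delta_in_distributions)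
    show "\<phi> k (face X (Suc k) i x) = face E (Suc k) i (\<phi> (Suc k) x)"
      if "x \<in> simp X (Suc k)" "i \<le> Suc k" for x k i
      using simplicial_mapD(2)[OF sm that] eq[OF that(1)] eq[OF simplicial_setD(1)[OF X that]]
      by (simp add: D_simps push_delta delta_inject)
    show "\<phi> (Suc k) (degen X k j x) = degen E k j (\<phi> k x)"
      if "x \<in> simp X k" "j \<le> k" for x k j
      using simplicial_mapD(3)[OF sm that] eq[OF that(1)] eq[OF simplicial_setD(2)[OF X that]]
      by (simp add: D_simps push_delta delta_inject)
  qed
  moreover have "f k (\<phi> k x) = x" if "x \<in> simp X k" for k x
  proof -
    have "push (f k) (p k x) = delta x" using p that by (simp add: sDist_def)
    then show ?thesis by (simp add: eq[OF that] push_delta delta_inject)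
  qed
  ultimately show ?thesis using eq unfolding deterministic_def is_section_def by blast
qed

lemma deterministic_imp_noncontextual:
  assumes "deterministic E X f p"
  shows "noncontextual E X f p"
  unfolding noncontextual_def
  using assms by (intro exI[of _ "1::nat"] exI[of _ "\<lambda>_. 1"] exI[of _ "\<lambda>_. p"]) simp

text \<open>Some section occurs with positive weight, and the other summands are nonnegative, so its
  edges stay in the support of \<open>p\<close>.\<close>

lemma noncontextual_imp_section:
  assumes p: "p \<in> sDist (circle_bundle n m) (circle n) bundle_map"
    and nc: "noncontextual (circle_bundle n m) (circle n) bundle_map p"
  obtains s where "\<And>i. i \<in> {1..n} \<Longrightarrow> edge_prob p i (s i, s (circle_succ n i)) \<noteq> 0"
proof -
  from nc[unfolded noncontextual_def] obtain N :: nat and w q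
    where det: "\<forall>r<N. 0 \<le> w r \<and> deterministic (circle_bundle n m) (circle n) bundle_map (q r)"
    and w: "(\<Sum>r<N. w r) = (1::real)"
    and eq: "\<forall>k. \<forall>x\<in>simp (circle n) k. \<forall>e. p k x e = (\<Sum>r<N. w r * q r k x e)"
    by blast
  have "\<exists>r<N. w r \<noteq> 0"
  proof (rule ccontr)
    assume "\<not> (\<exists>r<N. w r \<noteq> 0)"
    then have "(\<Sum>r<N. w r) = 0" by (intro sum.neutral) auto
    then show False using w by simp
  qed
  then obtain r where r: "r < N" "w r > 0" using det by (auto simp: order_less_le)
  then obtain \<phi> where sec: "is_section (circle_bundle n m) (circle n) bundle_map \<phi>"
    and q: "\<And>k x. x \<in> simp (circle n) k \<Longrightarrow> q r k x = delta (\<phi> k x)"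
    using det unfolding deterministic_def by blast
  have nonneg: "0 \<le> w r' * q r' k x e" if "r' < N" "x \<in> simp (circle n) k" for r' k x e
  proof -
    have "deterministic (circle_bundle n m) (circle n) bundle_map (q r')" using det that(1) by blast
    then obtain \<psi> where "\<forall>k. \<forall>x\<in>simp (circle n) k. q r' k x = delta (\<psi> k x)"
      unfolding deterministic_def by blast
    then show ?thesis using det that by (simp add: delta_def)
  qed
  have sm: "simplicial_map (circle n) (circle_bundle n m) \<phi>" using sec by (simp add: is_section_def)
  \<comment> \<open>The labels of the section at the vertices; compatibility with \<open>d_1\<close>
    and \<open>d_0\<close> identifies them with the two labels on each edge.\<close>
  define s where "s i = hd (snd (\<phi> 0 (Vert i)))" for i
  have "edge_prob p i (s i, s (circle_succ n i)) \<noteq> 0" if i: "i \<in> {1..n}" for i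
  proof -
    let ?e = "circle_edge i"
    have e: "?e \<in> simp (circle n) (Suc 0)" using i by (simp add: circle_edge_def circle_simps)
    obtain x a b where ab: "\<phi> 1 ?e = (x, [a, b])"
      using simplicial_mapD(1)[OF sm e] by (auto simp: total_space_simps)
    have b: "b = s (circle_succ n i)"
      using simplicial_mapD(2)[OF sm e, of 0] ab
      by (simp add: s_def circle_simps circle_edge_def total_space_simps delete_nth_def)
    have a: "a = s i"
      using simplicial_mapD(2)[OF sm e, of 1] ab
      by (simp add: s_def circle_simps circle_edge_def total_space_simps delete_nth_def)
    have "w r * q r 1 ?e (\<phi> 1 ?e) \<le> p 1 ?e (\<phi> 1 ?e)"
    proof -
      have "p 1 ?e (\<phi> 1 ?e) = (\<Sum>r<N. w r * q r 1 ?e (\<phi> 1 ?e))"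
        using eq e unfolding One_nat_def by blast
      also have "\<dots> \<ge> w r * q r 1 ?e (\<phi> 1 ?e)"
        using r(1) nonneg e by (intro member_le_sum) auto
      finally show ?thesis .
    qed
    moreover have "q r 1 ?e (\<phi> 1 ?e) = 1" using q e by (simp add: delta_def)
    ultimately have "p 1 ?e (\<phi> 1 ?e) \<noteq> 0" using r(2) by simp
    from push_neq_0[OF sDist_edge[OF p i] this, of "\<lambda>e. (hd (snd e), last (snd e))"]
    show ?thesis using ab a b by (simp add: edge_prob_def)
  qed
  then show ?thesis by (rule that)
qed

lemma circulation_nonneg:
  assumes "circulation n m P" "i \<in> {1..n}"
  shows "0 \<le> P i u"
proof -
  have "P i \<in> distributions (label_pairs n m i)" using assms by (simp add: circulation_def)
  then show ?thesis unfolding distributions_def by blast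
qed

lemma circulation_cong:
  assumes n: "n \<ge> 1" and "\<And>i. i \<in> {1..n} \<Longrightarrow> P i = Q i" "circulation n m P"
  shows "circulation n m Q"
  using assms circle_succ_range[of _ n] by (auto simp: circulation_def)

text \<open>For two or more turns the support contains no section; for one turn each edge carries a
  point mass, so \<open>p\<close> is deterministic.\<close>

lemma cycle_distribution_contextual_iff:
  assumes n: "n \<ge> 1" and p: "p \<in> sDist (circle_bundle n m) (circle n) bundle_map"
    and c: "cycle_walk n k c" and eq: "\<And>i. i \<in> {1..n} \<Longrightarrow> edge_prob p i = cycle_prob n k c i"
  shows "contextual (circle_bundle n m) (circle n) bundle_map p \<longleftrightarrow> k \<ge> 2"
proof
  assume "k \<ge> 2"
  have False if nc: "noncontextual (circle_bundle n m) (circle n) bundle_map p"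
  proof -
    obtain s where "\<And>i. i \<in> {1..n} \<Longrightarrow> edge_prob p i (s i, s (circle_succ n i)) \<noteq> 0"
      using noncontextual_imp_section[OF p nc] by blast
    then show False using cycle_walk_no_section[OF n c \<open>k \<ge> 2\<close>, of s] eq by simp
  qed
  then show "contextual (circle_bundle n m) (circle n) bundle_map p"
    using p by (auto simp: contextual_def)
next
  assume con: "contextual (circle_bundle n m) (circle n) bundle_map p"
  show "k \<ge> 2"
  proof (rule ccontr)
    assume "\<not> k \<ge> 2"
    moreover have "k \<ge> 1" using c unfolding cycle_walk_def by blast
    ultimately have k: "k = 1" by simp
    \<comment> \<open>The single turn visits \<open>v_i\<close> at time
      \<open>i - 1\<close>.\<close>
    define s where "s i = (c (i - 1), c i)" for i
    have "edge_prob p i = delta (s i)" if i: "i \<in> {1..n}" for i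
    proof
      fix u
      have "(\<exists>t. layer n t = i \<and> u = (c t, c (Suc t))) \<longleftrightarrow> u = s i"
        using cycle_walk_edges[OF n c i, of u] i by (auto simp: k s_def)
      then show "edge_prob p i u = delta (s i) u"
        by (simp add: eq[OF i] cycle_prob_def delta_def k)
    qed
    then have "p k x = delta (labelled k x (s (base_index x)))" if "x \<in> simp (circle n) k" for k x
      using sDist_eq_of_edges[OF p circulation_edge_prob[OF p] refl that] base_index_range[OF that]
      by (simp add: of_edges_def push_delta)
    then have "noncontextual (circle_bundle n m) (circle n) bundle_map p"
      by (intro deterministic_imp_noncontextual deterministicI[OF simplicial_set_circle p])
    then show False using con by (simp add: contextual_def)
  qed
qed

section \<open>Vertices\<close>

lemma edge_prob_combination:
  assumes q: "q \<in> sDist (circle_bundle n m) (circle n) bundle_map"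
    and q': "q' \<in> sDist (circle_bundle n m) (circle n) bundle_map" and i: "i \<in> {1..n}"
    and eq: "\<And>e. p 1 (circle_edge i) e = a * q 1 (circle_edge i) e + b * q' 1 (circle_edge i) e"
  shows "edge_prob p i u = a * edge_prob q i u + b * edge_prob q' i u"
proof -
  have "p 1 (circle_edge i) = (\<lambda>e. a * q 1 (circle_edge i) e + b * q' 1 (circle_edge i) e)"
    using eq by blast
  then show ?thesis
    unfolding edge_prob_def by (simp only: push_linear[OF sDist_edge[OF q i] sDist_edge[OF q' i]])
qed

text \<open>A coefficient may be negative: the remainder after removing a multiple of a cycle has
  this form, and its nonnegativity is checked separately.\<close>

lemma distributions_combination:
  assumes p: "p \<in> distributions U" and q: "q \<in> distributions U" and ab: "a + b = 1"
    and nonneg: "\<And>u. 0 \<le> a * p u + b * q u"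
  shows "(\<lambda>u. a * p u + b * q u) \<in> distributions U"
proof (rule distributionsI)
  let ?A = "{u. p u \<noteq> 0} \<union> {u. q u \<noteq> 0}"
  show A: "finite ?A" "?A \<subseteq> U" using p q by (auto simp: distributions_def)
  have "sum p ?A = 1" "sum q ?A = 1"
    by (rule distributions_sum[OF p A(1)]; blast) (rule distributions_sum[OF q A(1)]; blast)
  then show "(\<Sum>u\<in>?A. a * p u + b * q u) = 1"
    using ab by (simp add: sum.distrib flip: sum_distrib_left)
qed (use nonneg in auto)

lemma circulation_combination:
  assumes P: "circulation n m P" and Q: "circulation n m Q" and ab: "a + b = 1"
    and nonneg: "\<And>i u. i \<in> {1..n} \<Longrightarrow> 0 \<le> a * P i u + b * Q i u"
  shows "circulation n m (\<lambda>i u. a * P i u + b * Q i u)"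
  unfolding circulation_def
proof (intro ballI conjI)
  fix i assume i: "i \<in> {1..n}"
  then have s: "circle_succ n i \<in> {1..n}" using circle_succ_range by auto
  note d = P[unfolded circulation_def, rule_format] Q[unfolded circulation_def, rule_format]
  show "(\<lambda>u. a * P i u + b * Q i u) \<in> distributions (label_pairs n m i)"
    using d i by (intro distributions_combination ab nonneg) auto
  show "push snd (\<lambda>u. a * P i u + b * Q i u)
      = push fst (\<lambda>u. a * P (circle_succ n i) u + b * Q (circle_succ n i) u)"
    using d(1)[OF i] d(2)[OF i]
    by (simp only: push_linear[OF conjunct1[OF d(1)[OF i]] conjunct1[OF d(2)[OF i]]]
        push_linear[OF conjunct1[OF d(1)[OF s]] conjunct1[OF d(2)[OF s]]])
qed

text \<open>A component \<open>q\<close> of positive weight has its support inside that of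
  \<open>p\<close>, hence on the cycle, where only one circulation lives.\<close>

lemma cycle_distribution_vertex:
  assumes n: "n \<ge> 1" and p: "p \<in> sDist (circle_bundle n m) (circle n) bundle_map"
    and c: "cycle_walk n k c" and eq: "\<And>i. i \<in> {1..n} \<Longrightarrow> edge_prob p i = cycle_prob n k c i"
  shows "vertex (circle_bundle n m) (circle n) bundle_map p"
  unfolding vertex_def
proof (intro conjI p ballI allI impI)
  fix q q' :: "nat \<Rightarrow> circ \<Rightarrow> circ \<times> nat list \<Rightarrow> real" and \<alpha> :: real and k' x
  assume q: "q \<in> sDist (circle_bundle n m) (circle n) bundle_map"
    and q': "q' \<in> sDist (circle_bundle n m) (circle n) bundle_map"
    and \<alpha>: "0 < \<alpha>" "\<alpha> \<le> 1" and x: "x \<in> simp (circle n) k'"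
    and comb: "\<forall>k. \<forall>x\<in>simp (circle n) k. \<forall>e. p k x e = \<alpha> * q k x e + (1 - \<alpha>) * q' k x e"
  have P: "circulation n m (cycle_prob n k c)"
    by (rule circulation_cong[OF n eq circulation_edge_prob[OF p]])
  have "cycle_prob n k c i u \<noteq> 0" if i: "i \<in> {1..n}" and u: "edge_prob q i u \<noteq> 0" for i u
  proof -
    have e: "circle_edge i \<in> simp (circle n) 1" using i by (simp add: circle_edge_def circle_simps)
    have "edge_prob p i u = \<alpha> * edge_prob q i u + (1 - \<alpha>) * edge_prob q' i u"
      using comb e by (intro edge_prob_combination[OF q q' i]) blast
    moreover have "0 \<le> edge_prob q i u" "0 \<le> edge_prob q' i u"
      using circulation_nonneg[OF circulation_edge_prob] q q' i by blast+
    then have "0 < \<alpha> * edge_prob q i u" "0 \<le> (1 - \<alpha>) * edge_prob q' i u"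
      using u \<alpha> by auto
    ultimately show ?thesis using eq[OF i] by auto
  qed
  then have "edge_prob q i = edge_prob p i" if "i \<in> {1..n}" for i
    using circulation_supported_on_cycle[OF n c P circulation_edge_prob[OF q] _ that] eq[OF that] by simp
  then have "q k' x = of_edges (edge_prob p) k' x"
    by (rule sDist_eq_of_edges[OF q circulation_edge_prob[OF p] _ x])
  then show "p k' x = q k' x"
    using sDist_eq_of_edges[OF p circulation_edge_prob[OF p] refl x] by simp
qed

text \<open>Subtracting a small multiple of a cycle contained in the support exhibits \<open>p\<close> as a proper
  convex combination in which that cycle occurs.\<close>

lemma vertex_imp_cycle:
  assumes n: "n \<ge> 1" and v: "vertex (circle_bundle n m) (circle n) bundle_map p"
  obtains k c where "cycle_walk n k c" "\<And>i. i \<in> {1..n} \<Longrightarrow> edge_prob p i = cycle_prob n k c i"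
proof -
  have p: "p \<in> sDist (circle_bundle n m) (circle n) bundle_map" using v by (simp add: vertex_def)
  let ?P = "edge_prob p"
  have P: "circulation n m ?P" by (rule circulation_edge_prob[OF p])
  obtain k c where c: "cycle_walk n k c" and pos: "\<And>t. ?P (layer n t) (c t, c (Suc t)) \<noteq> 0"
    using circulation_contains_cycle[OF n P] by blast
  have k: "k \<ge> 1" using c unfolding cycle_walk_def by blast
  let ?Q = "cycle_prob n k c"
  have nonneg: "0 \<le> ?P i u" if "i \<in> {1..n}" for i u
    by (rule circulation_nonneg[OF P that])
  have "c t < m (Vert (layer n t))" for t
  proof -
    have "?P (layer n t) \<in> distributions (label_pairs n m (layer n t))"
      using P layer_range[OF n, of t] unfolding circulation_def by blast
    then show ?thesis using pos[of t] by (auto simp: distributions_def)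
  qed
  then have Q: "circulation n m ?Q" by (rule circulation_cycle_prob[OF n c])
  define g where "g t = ?P (layer n t) (c t, c (Suc t))" for t
  \<comment> \<open>Least mass of \<open>p\<close> on an edge of the cycle; by periodicity one
    period suffices, so the minimum is over a finite set.\<close>
  define \<mu> where "\<mu> = Min (g ` {..<n * k})"
  have "0 < n * k" using n k by simp
  then have fin: "finite (g ` {..<n * k})" "g ` {..<n * k} \<noteq> {}" by (simp_all add: lessThan_empty_iff)
  have g_pos: "0 < g t" for t
    using nonneg[OF layer_range[OF n]] pos[of t] by (simp add: g_def order_less_le)
  then have \<mu>: "0 < \<mu>" using fin by (simp add: \<mu>_def)
  have g_ge: "\<mu> \<le> g t" for t
  proof -
    let ?r = "t mod (n * k)"
    have l: "layer n ?r = layer n t" by (simp add: mod_mod_cancel)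
    have "c ?r = c t" by (rule cycle_walk_mod[OF c])
    moreover have "c (Suc ?r) = c (Suc t)"
      using cycle_walk_Suc[OF c l] \<open>c ?r = c t\<close> by simp
    ultimately have "g t = g ?r" using l by (simp add: g_def)
    moreover have "?r < n * k" using n k by simp
    ultimately show ?thesis unfolding \<mu>_def using fin(1) by (intro Min_le) auto
  qed
  \<comment> \<open>The bound \<open>\<mu>\<close> keeps the remainder nonnegative; 1/2 keeps
    \<open>1 - \<alpha>\<close> positive, as \<open>\<mu>\<close> may equal 1.\<close>
  define \<alpha> where "\<alpha> = min (1 / 2) \<mu>"
  have \<alpha>: "0 < \<alpha>" "\<alpha> < 1" using \<mu> by (auto simp: \<alpha>_def)
  have le: "\<alpha> * ?Q i u \<le> ?P i u" if i: "i \<in> {1..n}" for i u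
  proof (cases "?Q i u = 0")
    case True
    then show ?thesis using nonneg[OF i] by simp
  next
    case False
    then obtain t where t: "layer n t = i" "u = (c t, c (Suc t))"
      unfolding cycle_prob_neq_0[OF c] by blast
    have "?Q i u \<le> 1" using k by (simp add: cycle_prob_def)
    then have "\<alpha> * ?Q i u \<le> \<alpha>" using \<alpha> by (simp add: mult_left_le)
    also have "\<dots> \<le> \<mu>" by (simp add: \<alpha>_def)
    also have "\<dots> \<le> ?P i u" using g_ge[of t] t by (simp add: g_def)
    finally show ?thesis .
  qed
  \<comment> \<open>Coefficients obtained by solving
    \<open>P = \<alpha> Q + (1 - \<alpha>) R\<close> for \<open>R\<close>.\<close>
  let ?a = "1 / (1 - \<alpha>)" and ?b = "- \<alpha> / (1 - \<alpha>)"
  define R where "R i u = ?a * ?P i u + ?b * ?Q i u" for i u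
  have ab: "?a + ?b = 1" using \<alpha> by (simp add: field_simps)
  have R_nonneg: "0 \<le> ?a * ?P i u + ?b * ?Q i u" if "i \<in> {1..n}" for i u
  proof -
    have "?a * ?P i u + ?b * ?Q i u = (?P i u - \<alpha> * ?Q i u) / (1 - \<alpha>)"
      by (simp add: diff_divide_distrib)
    then show ?thesis using le[OF that, of u] \<alpha> by simp
  qed
  have R: "circulation n m R"
    unfolding R_def by (rule circulation_combination[OF P Q ab R_nonneg])
  have comb: "?P i = (\<lambda>u. \<alpha> * ?Q i u + (1 - \<alpha>) * R i u)" for i
  proof
    fix u
    have "R i u = (?P i u - \<alpha> * ?Q i u) / (1 - \<alpha>)"
      by (simp add: R_def diff_divide_distrib)
    then have "(1 - \<alpha>) * R i u = ?P i u - \<alpha> * ?Q i u" using \<alpha> by simp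
    then show "?P i u = \<alpha> * ?Q i u + (1 - \<alpha>) * R i u" by simp
  qed
  have "\<forall>k. \<forall>x\<in>simp (circle n) k. \<forall>e. p k x e = \<alpha> * of_edges ?Q k x e + (1 - \<alpha>) * of_edges R k x e"
  proof (intro allI ballI)
    fix l x e assume x: "x \<in> simp (circle n) l"
    let ?i = "base_index x"
    have d: "?Q ?i \<in> distributions (label_pairs n m ?i)" "R ?i \<in> distributions (label_pairs n m ?i)"
      using Q R base_index_range[OF x] by (auto simp: circulation_def)
    have "p l x e = push (labelled l x) (?P ?i) e"
      using sDist_eq_of_edges[OF p P refl x] by (simp add: of_edges_def)
    then show "p l x e = \<alpha> * of_edges ?Q l x e + (1 - \<alpha>) * of_edges R l x e"
      unfolding comb[of ?i] push_linear[OF d] of_edges_def .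
  qed
  \<comment> \<open>The cycle is put first in the combination, so extremality equates
    \<open>p\<close> with it.\<close>
  then have "\<forall>k. \<forall>x\<in>simp (circle n) k. p k x = of_edges ?Q k x"
    using v of_edges_sDist[OF Q] of_edges_sDist[OF R] \<alpha> unfolding vertex_def by (meson less_imp_le)
  then have "?P i = ?Q i" if i: "i \<in> {1..n}" for i
    using edge_prob_of_edges[OF Q i] i unfolding edge_prob_def by (simp add: circle_edge_def circle_simps)
  with c show ?thesis by (rule that)
qed

section \<open>Cycle distributions in terms of walks\<close>

lemma edge_prob_Delta:
  assumes p: "p \<in> sDist (circle_bundle n m) (circle n) bundle_map" and i: "i \<in> {1..n}"
  shows "push snd (push (incl 1) (p 1 (circle_edge i))) [x, y] = edge_prob p i (x, y)"
proof -
  have d: "edge_prob p i \<in> distributions (label_pairs n m i)"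
    using circulation_edge_prob[OF p] i by (simp add: circulation_def)
  have eq: "push snd (push (incl 1) (p 1 (circle_edge i))) = push (\<lambda>u. snd (incl 1 (labelled 1 (circle_edge i) u))) (edge_prob p i)"
    unfolding of_edges_edge_prob_edge[OF p i, symmetric]
    by (simp add: of_edges_def circle_edge_def push_push[OF d] push_push[OF distributions_push[OF d subset_refl[THEN subsetD, OF imageI]]]
      del: labelled.simps)
  show ?thesis
    unfolding eq by (rule push_eqI) (auto simp: incl_def circle_edge_def)
qed

text \<open>Within a turn consecutive layers share the index \<open>j\<close>; only the step over
  \<open>\<sigma>_n\<close> passes to the next turn.\<close>

lemma cycle_prob_explicit:
  assumes n: "n \<ge> 1" and c: "cycle_walk n k c"
    and a: "\<forall>i\<in>{1..n}. \<forall>j\<in>{1..k}. a i j = c (n * (j - 1) + (i - 1))"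
  shows "i \<in> {1..<n} \<Longrightarrow> cycle_prob n k c i u
      = (if \<exists>j\<in>{1..k}. u = (a i j, a (i + 1) j) then 1 / real k else 0)"
    and "cycle_prob n k c n u
      = (if (\<exists>j\<in>{1..<k}. u = (a n j, a 1 (j + 1))) \<or> u = (a n k, a 1 1) then 1 / real k else 0)"
proof -
  have k: "k \<ge> 1" using c unfolding cycle_walk_def by blast
  have shift: "(\<exists>j<k. Q j) \<longleftrightarrow> (\<exists>j\<in>{1..k}. Q (j - 1))" for Q
    by (rule iffI; force)
  have edges: "cycle_prob n k c i u = (if \<exists>j\<in>{1..k}. u = (a i j, c (Suc (n * (j - 1) + (i - 1)))) then 1 / real k else 0)"
    if i: "i \<in> {1..n}" for i
    unfolding cycle_prob_def cycle_walk_edges[OF n c i] shift using a i by simp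
  show "cycle_prob n k c i u = (if \<exists>j\<in>{1..k}. u = (a i j, a (i + 1) j) then 1 / real k else 0)"
    if i: "i \<in> {1..<n}"
  proof -
    have "c (Suc (n * (j - 1) + (i - 1))) = a (i + 1) j" if "j \<in> {1..k}" for j
      using a i that by simp
    then show ?thesis using edges[of i] i by simp
  qed
  \<comment> \<open>Leaving layer \<open>n\<close> in turn \<open>j\<close> leads to time
    \<open>n * j\<close>, the start of turn \<open>j + 1\<close>; for \<open>j = k\<close>
    periodicity returns to time 0.\<close>
  have "c (Suc (n * (j - 1) + (n - 1))) = (if j = k then a 1 1 else a 1 (j + 1))" if j: "j \<in> {1..k}" for j
  proof -
    have "Suc (n * (j - 1) + (n - 1)) = n * j" using n j by (cases j) auto
    moreover have "c (0 + n * k) = c 0" using c unfolding cycle_walk_def by blast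
    ultimately show ?thesis using a n k j by simp
  qed
  then have "(\<exists>j\<in>{1..k}. u = (a n j, c (Suc (n * (j - 1) + (n - 1)))))
      \<longleftrightarrow> (\<exists>j\<in>{1..k}. u = (a n j, if j = k then a 1 1 else a 1 (j + 1)))"
    by (intro bex_cong) auto
  also have "\<dots> \<longleftrightarrow> (\<exists>j\<in>{1..<k}. u = (a n j, a 1 (j + 1))) \<or> u = (a n k, a 1 1)"
    using k by force
  finally show "cycle_prob n k c n u
      = (if (\<exists>j\<in>{1..<k}. u = (a n j, a 1 (j + 1))) \<or> u = (a n k, a 1 1) then 1 / real k else 0)"
    using edges[of n] n by simp
qed

lemma cycle_distribution_iff_walk:
  assumes n: "n \<ge> 1" and p: "p \<in> sDist (circle_bundle n m) (circle n) bundle_map"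
  shows "cycle_distribution n m k p
    \<longleftrightarrow> (\<exists>c. cycle_walk n k c \<and> (\<forall>i\<in>{1..n}. edge_prob p i = cycle_prob n k c i))"
proof -
  define d where "d = Max (m ` simp (circle n) 0)"
  have simp0: "simp (circle n) 0 = Vert ` {1..n}" by (auto simp: circle_def)
  have m_le: "m (Vert i) \<le> d" if "i \<in> {1..n}" for i
    unfolding d_def simp0 using that by (intro Max_ge) auto
  have P: "circulation n m (edge_prob p)" by (rule circulation_edge_prob[OF p])
  have supp: "fst u < m (Vert i) \<and> snd u < m (Vert (circle_succ n i))"
    if "i \<in> {1..n}" "edge_prob p i u \<noteq> 0" for i u
    using P that by (fastforce simp: circulation_def distributions_def)
  have "simplicial_map (circle n) (D (Delta {..<d})) (\<lambda>l x. push snd (push (incl l) (p l x)))"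
  proof (rule simplicial_map_comp[where g = "\<lambda>_. push snd"])
    show "simplicial_map (circle n) (D (prod_sset (circle n) (Delta {..<d}))) (\<lambda>l x. push (incl l) (p l x))"
    proof (rule simplicial_map_comp[where g = "\<lambda>l. push (incl l)"])
      show "simplicial_map (circle n) (D (circle_bundle n m)) p" using p by (simp add: sDist_def)
      show "simplicial_map (D (circle_bundle n m)) (D (prod_sset (circle n) (Delta {..<d}))) (\<lambda>l. push (incl l))"
        using m_le by (intro simplicial_map_push simplicial_map_incl simplicial_set_circle) (auto simp: simp0)
    qed
    show "simplicial_map (D (prod_sset (circle n) (Delta {..<d}))) (D (Delta {..<d})) (\<lambda>_. push snd)"
      by (intro simplicial_map_push) (auto simp: simplicial_map_def prod_sset_def)
  qed
  moreover have "i \<in> {1..<n} \<Longrightarrow> push snd (push (incl 1) (p 1 (circle_edge i))) [x, y] = edge_prob p i (x, y)"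
    and "push snd (push (incl 1) (p 1 (circle_edge n))) [x, y] = edge_prob p n (x, y)" for i x y
    using edge_prob_Delta[OF p] n by auto
  ultimately have "cycle_distribution n m k p \<longleftrightarrow> 1 \<le> k \<and> k \<le> d \<and>
     (\<exists>a :: nat \<Rightarrow> nat \<Rightarrow> nat.
        (\<forall>i\<in>{1..n}. \<forall>j\<in>{1..k}. a i j < d) \<and>
        (\<forall>i\<in>{1..n}. \<forall>j\<in>{1..k}. \<forall>s\<in>{1..k}. j \<noteq> s \<longrightarrow> a i j \<noteq> a i s) \<and>
        (\<forall>i\<in>{1..<n}. \<forall>x<d. \<forall>y<d. edge_prob p i (x, y) =
             (if \<exists>j\<in>{1..k}. (x, y) = (a i j, a (i + 1) j) then 1 / real k else 0)) \<and>
        (\<forall>x<d. \<forall>y<d. edge_prob p n (x, y) =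
             (if (\<exists>j\<in>{1..<k}. (x, y) = (a n j, a 1 (j + 1))) \<or> (x, y) = (a n k, a 1 1)
              then 1 / real k else 0)))" (is "_ \<longleftrightarrow> ?R")
    unfolding cycle_distribution_def cycle_distribution_Delta_def d_def[symmetric]
    using p by (simp only: simp_thms cong: ball_cong)
  also have "?R \<longleftrightarrow> (\<exists>c. cycle_walk n k c \<and> (\<forall>i\<in>{1..n}. edge_prob p i = cycle_prob n k c i))"
  proof
    assume ?R
    then obtain a :: "nat \<Rightarrow> nat \<Rightarrow> nat" where k: "1 \<le> k"
      and a_lt: "\<forall>i\<in>{1..n}. \<forall>j\<in>{1..k}. a i j < d"
      and a_inj: "\<forall>i\<in>{1..n}. \<forall>j\<in>{1..k}. \<forall>s\<in>{1..k}. j \<noteq> s \<longrightarrow> a i j \<noteq> a i s"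
      and p1: "\<forall>i\<in>{1..<n}. \<forall>x<d. \<forall>y<d. edge_prob p i (x, y) =
             (if \<exists>j\<in>{1..k}. (x, y) = (a i j, a (i + 1) j) then 1 / real k else 0)"
      and p2: "\<forall>x<d. \<forall>y<d. edge_prob p n (x, y) =
             (if (\<exists>j\<in>{1..<k}. (x, y) = (a n j, a 1 (j + 1))) \<or> (x, y) = (a n k, a 1 1)
              then 1 / real k else 0)"
      by (elim exE conjE)
    \<comment> \<open>Time \<open>t\<close> falls in turn \<open>t div n mod k\<close>, counted from
      0, while the second index of \<open>a\<close> starts at 1.\<close>
    define c where "c t = a (layer n t) (Suc (t div n mod k))" for t
    have rng: "layer n t \<in> {1..n}" "Suc (t div n mod k) \<in> {1..k}" for t
      using layer_range[OF n] k by (auto simp: Suc_le_eq)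
    have walk: "cycle_walk n k c"
      unfolding cycle_walk_def
    proof (intro conjI allI impI)
      show "c (t + n * k) = c t" for t using n by (simp add: c_def)
      fix s t assume st: "s mod n = t mod n" "c s = c t"
      then have "s div n mod k = t div n mod k"
        using a_inj[rule_format, OF rng(1)[of t] rng(2)[of s] rng(2)[of t]] by (auto simp: c_def)
      then show "s mod (n * k) = t mod (n * k)" using st(1) by (simp add: mod_mult2_eq)
    qed (rule k)
    have ac: "\<forall>i\<in>{1..n}. \<forall>j\<in>{1..k}. a i j = c (n * (j - 1) + (i - 1))"
    proof (intro ballI)
      fix i j assume that: "i \<in> {1..n}" "j \<in> {1..k}"
      have l: "layer n (n * (j - 1) + (i - 1)) = i" using cycle_index(1)[OF that(1)] .
      have "i - 1 < n" "n \<noteq> 0" using that(1) by auto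
      then have "(n * (j - 1) + (i - 1)) div n = j - 1" by simp
      moreover have "(j - 1) mod k = j - 1" "Suc (j - 1) = j" using that(2) by auto
      ultimately show "a i j = c (n * (j - 1) + (i - 1))" unfolding c_def l by simp
    qed
    have c_lt: "c t < d" for t unfolding c_def using a_lt rng by blast
    have "edge_prob p i (x, y) = cycle_prob n k c i (x, y)" if i: "i \<in> {1..n}" for i x y
    proof (cases "x < d \<and> y < d")
      case True
      show ?thesis
      proof (cases "i = n")
        case True
        show ?thesis
          unfolding True cycle_prob_explicit(2)[OF n walk ac]
          by (rule p2[rule_format]) (use \<open>x < d \<and> y < d\<close> in auto)
      next
        case False
        then have i': "i \<in> {1..<n}" using i by auto
        show ?thesis
          unfolding cycle_prob_explicit(1)[OF n walk ac i']
          by (rule p1[rule_format, OF i']) (use True in auto)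
      qed
    next
      \<comment> \<open>The definition constrains only labels below \<open>d\<close>. Elsewhere both
        sides vanish, since the labels in the bundle and those of the walk are below
        \<open>d\<close>.\<close>
      case False
      have "edge_prob p i (x, y) = 0"
      proof (rule ccontr)
        assume "edge_prob p i (x, y) \<noteq> 0"
        then have "x < m (Vert i)" "y < m (Vert (circle_succ n i))" using supp[OF i] by force+
        then show False using False m_le[OF i] m_le[OF circle_succ_range, of i] i by fastforce
      qed
      moreover have "cycle_prob n k c i (x, y) = 0"
        using False c_lt unfolding cycle_prob_def by auto
      ultimately show ?thesis by simp
    qed
    then show "\<exists>c. cycle_walk n k c \<and> (\<forall>i\<in>{1..n}. edge_prob p i = cycle_prob n k c i)"
      using walk by (intro exI[of _ c]) (auto simp: fun_eq_iff)
  next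
    assume "\<exists>c. cycle_walk n k c \<and> (\<forall>i\<in>{1..n}. edge_prob p i = cycle_prob n k c i)"
    then obtain c where walk: "cycle_walk n k c"
      and eq: "\<And>i. i \<in> {1..n} \<Longrightarrow> edge_prob p i = cycle_prob n k c i" by blast
    have k: "k \<ge> 1" using walk unfolding cycle_walk_def by blast
    define a where "a i j = c (n * (j - 1) + (i - 1))" for i j
    then have ac: "\<forall>i\<in>{1..n}. \<forall>j\<in>{1..k}. a i j = c (n * (j - 1) + (i - 1))" by simp
    have "c t < d" for t
    proof -
      have "cycle_prob n k c (layer n t) (c t, c (Suc t)) \<noteq> 0"
        unfolding cycle_prob_neq_0[OF walk] by blast
      then have "c t < m (Vert (layer n t))"
        using supp[OF layer_range[OF n, of t], of "(c t, c (Suc t))"] eq[OF layer_range[OF n, of t]] by simp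
      then show ?thesis using m_le[OF layer_range[OF n, of t]] by simp
    qed
    then have a_lt: "a i j < d" for i j by (simp add: a_def)
    have a_inj: "j = s" if ij: "i \<in> {1..n}" "j \<in> {1..k}" "s \<in> {1..k}" and eq: "a i j = a i s" for i j s
    proof -
      have "(n * (j - 1) + (i - 1)) mod (n * k) = (n * (s - 1) + (i - 1)) mod (n * k)"
        using eq unfolding a_def
        by (intro cycle_walk_distinct[OF walk]) (simp_all only: cycle_index(1)[OF ij(1)])
      moreover have "n * (j - 1) + (i - 1) < n * k" "n * (s - 1) + (i - 1) < n * k"
        using cycle_index(2)[OF ij(1), of "j - 1" k] cycle_index(2)[OF ij(1), of "s - 1" k] ij(2,3) by auto
      ultimately have "n * (j - 1) = n * (s - 1)" by simp
      then show ?thesis using n ij by auto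
    qed
    \<comment> \<open>The \<open>k\<close> labels in layer 1 are distinct and below
      \<open>d\<close>, which gives the bound on the order.\<close>
    have "inj_on (a 1) {1..k}" using a_inj[of 1] n by (intro inj_onI) auto
    then have "card {1..k} \<le> card {..<d}" using a_lt by (intro card_inj_on_le[of "a 1"]) auto
    then have "k \<le> d" by simp
    moreover have "edge_prob p i (x, y) = (if \<exists>j\<in>{1..k}. (x, y) = (a i j, a (i + 1) j) then 1 / real k else 0)"
      if "i \<in> {1..<n}" for i x y
      using eq[of i] that cycle_prob_explicit(1)[OF n walk ac that] by simp
    moreover have "edge_prob p n (x, y) = (if (\<exists>j\<in>{1..<k}. (x, y) = (a n j, a 1 (j + 1))) \<or> (x, y) = (a n k, a 1 1)
              then 1 / real k else 0)" for x y
      using eq[of n] n cycle_prob_explicit(2)[OF n walk ac] by simp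
    ultimately show ?R using k a_lt a_inj by blast
  qed
  finally show ?thesis .
qed

theorem corollary4p7:
  fixes n :: nat and m :: "circ \<Rightarrow> nat"
    and p :: "nat \<Rightarrow> circ \<Rightarrow> circ \<times> nat list \<Rightarrow> real"
  assumes "n \<ge> 1"
    and "\<And>x. x \<in> simp (circle n) 0 \<Longrightarrow> m x \<ge> 2"
    and "p \<in> sDist (total_space (circle n) m) (circle n) bundle_map"
  shows "(contextual (total_space (circle n) m) (circle n) bundle_map p \<and>
          vertex (total_space (circle n) m) (circle n) bundle_map p)
         \<longleftrightarrow> (\<exists>k\<ge>2. cycle_distribution n m k p)"
proof
  assume L: "contextual (circle_bundle n m) (circle n) bundle_map p \<and>
      vertex (circle_bundle n m) (circle n) bundle_map p"
  obtain k c where c: "cycle_walk n k c" "\<And>i. i \<in> {1..n} \<Longrightarrow> edge_prob p i = cycle_prob n k c i"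
    using vertex_imp_cycle[OF assms(1) conjunct2[OF L]] by blast
  then have "k \<ge> 2" using cycle_distribution_contextual_iff[OF assms(1,3) c] L by blast
  moreover have "cycle_distribution n m k p"
    using c by (auto simp: cycle_distribution_iff_walk[OF assms(1,3)])
  ultimately show "\<exists>k\<ge>2. cycle_distribution n m k p" by blast
next
  assume "\<exists>k\<ge>2. cycle_distribution n m k p"
  then obtain k c where k: "k \<ge> 2" and c: "cycle_walk n k c"
      "\<And>i. i \<in> {1..n} \<Longrightarrow> edge_prob p i = cycle_prob n k c i"
    unfolding cycle_distribution_iff_walk[OF assms(1,3)] by blast
  then show "contextual (circle_bundle n m) (circle n) bundle_map p \<and>
      vertex (circle_bundle n m) (circle n) bundle_map p"
    using cycle_distribution_contextual_iff[OF assms(1,3) c]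
      cycle_distribution_vertex[OF assms(1,3) c] by blast
qed

end
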